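(* Fix arbitrary sets $D_i$ ($0\le i\le5$), $D_6^L$, $D_6^R$, $D_8$ of left coset representatives of $N_i$, $N_6^L$, $N_6^R$, $N_8$ in $W(\mathrm{F}_4)$, and put $D_7^L=D_6^R$, $D_7^R=D_6^L$, $C_7=C_6$, $D_9^L=D_5$, $D_9^R=D_4$, $D_{10}^L=D_4$, $D_{10}^R=D_5$; for a set $D$ write $D^{-1}=\{d^{-1}:d\in D\}$. Then every monomial $a\in\mathrm{BrM}(\mathrm{F}_4)$ equals $\delta^k$ times an element of one of the following forms, for some $k\in\mathbb Z$: (I) $u\,e_{X_i}\,v\,w$ with $0\le i\le5$, $u\in D_i$, $v\in C_i$, $w\in D_i^{-1}$; (II) $u\,e_3e_2\,v\,w$ with $u\in D_6^L$, $v\in C_6$, $w\in(D_6^R)^{-1}$; (III) $u\,e_2e_3\,v\,w$ with $u\in D_7^L$, $v\in C_7$, $w\in(D_7^R)^{-1}$; (IV) $u\,e_4r_3e_2e_3e_4\,w$ with $u\in D_8$, $w\in D_8^{-1}$; (V) $u\,e_3e_2e_1e_3\,w$ with $u\in D_9^L$, $w\in(D_9^R)^{-1}$; (VI) $u\,e_3e_1e_2e_3\,w$ with $u\in D_{10}^L$, $w\in(D_{10}^R)^{-1}$.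
   Context: $\mathrm{Br}(\mathrm{F}_4)$ is the unital associative $\mathbb Z[\delta^{\pm1}]$-algebra ($\delta$ an indeterminate) generated by $r_1,\dots,r_4,e_1,\dots,e_4$ subject to: $r_i^2=1$, $r_ie_i=e_ir_i=e_i$ for all $i$; $e_i^2=\delta e_i$ for $i\in\{3,4\}$; $e_i^2=\delta^2e_i$ for $i\in\{1,2\}$; for $\{i,j\}\in\{\{1,3\},\{1,4\},\{2,4\}\}$: $r_ir_j=r_jr_i$, $e_ir_j=r_je_i$, $e_ie_j=e_je_i$; for $(i,j)\in\{(1,2),(2,1),(3,4),(4,3)\}$: $r_ir_jr_i=r_jr_ir_j$, $r_jr_ie_j=e_ie_j$, $r_ie_jr_i=r_je_ir_j$; and $r_2r_3r_2r_3=r_3r_2r_3r_2$, $r_2r_3e_2=r_3e_2$, $r_2e_3r_2e_3=e_3e_2e_3$, $(r_2r_3r_2)e_3=e_3(r_2r_3r_2)$, $e_2r_3e_2=\delta e_2$, $e_2e_3e_2=\delta e_2$, $e_2r_3r_2=e_2r_3$, $e_2e_3r_2=e_2e_3$. $\mathrm{BrM}(\mathrm{F}_4)$ is the monoid generated by $\delta^{\pm1}$ and the $r_i,e_i$. Roots: $\epsilon_1,\dots,\epsilon_4$ standard basis of $\mathbb R^4$; $\beta_1=\frac12(\epsilon_1-\epsilon_2-\epsilon_3-\epsilon_4)$, $\beta_2=\epsilon_2$, $\beta_3=\epsilon_3-\epsilon_2$, $\beta_4=\epsilon_4-\epsilon_3$; $\Psi$ the $\mathrm{F}_4$ root system $\{\pm\epsilon_i\}\cup\{\pm\epsilon_i\pm\epsilon_j:i<j\}\cup\{\frac12(\pm\epsilon_1\pm\epsilon_2\pm\epsilon_3\pm\epsilon_4)\}$,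 $\Psi^+$ its roots that are nonnegative combinations of the $\beta_i$; a root and its negative are identified when naming positive roots. $W(\mathrm{F}_4)$ is generated by the reflections $s_{\beta_i}$ and identified with its image in $\mathrm{Br}(\mathrm{F}_4)$ via $s_{\beta_i}\mapsto r_i$; $r_\beta$ denotes the reflection in the root $\beta$. For $\beta\in\Psi^+$, $e_\beta:=we_jw^{-1}$ for any $w$, $j$ with $w\beta_j=\beta$ (well defined), and $e_X=\prod_{\beta\in X}e_\beta$ for the sets below (factors commute). Sets: $X_0=\emptyset$, $X_1=\{\beta_4\}$, $X_2=\{\beta_1\}$, $X_3=\{\epsilon_3-\epsilon_2,\epsilon_3+\epsilon_2\}$, $X_4=\{\beta_1,\beta_3,\epsilon_1+\epsilon_4\}$, $X_5=\{\epsilon_3-\epsilon_2,\epsilon_3+\epsilon_2,\epsilon_4+\epsilon_1,\epsilon_4-\epsilon_1\}$. Subgroups: $N_0=C_0=W(\mathrm{F}_4)$; $N_1=\langle r_1,r_2,r_{\epsilon_4+\epsilon_3},r_4\rangle$, $C_1=\langle r_1,r_2,r_{\epsilon_4+\epsilon_3}\rangle$; $N_2=\langle r_1,r_3,r_4,r_{(\epsilon_1+\epsilon_2+\epsilon_3-\epsilon_4)/2}\rangle$, $C_2=\langle r_3,r_4\rangle$; $N_3=\langle r_2,r_3,r_{\epsilon_4},r_{\epsilon_4-\epsilon_1}\rangle$, $C_3=\langle r_{\epsilon_4-\epsilon_1}\rangle$; $N_4=\langle r_3,r_1,r_{(\epsilon_1+\epsilon_2+\epsilon_3-\epsilon_4)/2},r_{(\epsilon_1-\epsilon_2+\epsilon_3+\epsilon_4)/2}\rangle$,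 $C_4=\{1\}$; $N_5=\langle r_1,r_2,r_3,r_{\epsilon_4},r_{\epsilon_1}\rangle$, $C_5=\{1\}$; $N_6^L=\langle r_2,r_3,r_{\epsilon_4},r_{\epsilon_4-\epsilon_1}\rangle$, $N_6^R=\langle r_2,r_{\epsilon_3},r_{\epsilon_4},r_{\epsilon_4-\epsilon_1}\rangle$, $C_6=\langle r_{\epsilon_4-\epsilon_1}\rangle$, $N_8=\langle r_2,r_4,r_{\epsilon_1},r_{\epsilon_3}\rangle$. *)

theory Defs
  imports "HOL-Analysis.Analysis"
begin

datatype letter = R nat | E nat | Dl | Di

definition valid_letter :: "letter \<Rightarrow> bool" where
  "valid_letter x \<longleftrightarrow> (case x of R i \<Rightarrow> i \<in> {1..4} | E i \<Rightarrow> i \<in> {1..4} | _ \<Rightarrow> True)"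

text \<open>Defining relations of Br(F4); all are monomial, and delta is a central invertible scalar.\<close>
inductive brrel :: "letter list \<Rightarrow> letter list \<Rightarrow> bool" where
  rr: "i \<in> {1..4} \<Longrightarrow> brrel [R i, R i] []"
| re: "i \<in> {1..4} \<Longrightarrow> brrel [R i, E i] [E i]"
| er: "i \<in> {1..4} \<Longrightarrow> brrel [E i, R i] [E i]"
| ee_short: "i \<in> {3,4} \<Longrightarrow> brrel [E i, E i] [Dl, E i]"
| ee_long: "i \<in> {1,2} \<Longrightarrow> brrel [E i, E i] [Dl, Dl, E i]"
| comm_rr: "(i,j) \<in> {(1,3),(3,1),(1,4),(4,1),(2,4),(4,2)} \<Longrightarrow> brrel [R i, R j] [R j, R i]"
| comm_er: "(i,j) \<in> {(1,3),(3,1),(1,4),(4,1),(2,4),(4,2)} \<Longrightarrow> brrel [E i, R j] [R j, E i]"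
| comm_ee: "(i,j) \<in> {(1,3),(3,1),(1,4),(4,1),(2,4),(4,2)} \<Longrightarrow> brrel [E i, E j] [E j, E i]"
| braid3: "(i,j) \<in> {(1,2),(2,1),(3,4),(4,3)} \<Longrightarrow> brrel [R i, R j, R i] [R j, R i, R j]"
| a1: "(i,j) \<in> {(1,2),(2,1),(3,4),(4,3)} \<Longrightarrow> brrel [R j, R i, E j] [E i, E j]"
| a2: "(i,j) \<in> {(1,2),(2,1),(3,4),(4,3)} \<Longrightarrow> brrel [R i, E j, R i] [R j, E i, R j]"
| b1: "brrel [R 2, R 3, R 2, R 3] [R 3, R 2, R 3, R 2]"
| b2: "brrel [R 2, R 3, E 2] [R 3, E 2]"
| b3: "brrel [R 2, E 3, R 2, E 3] [E 3, E 2, E 3]"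
| b4: "brrel [R 2, R 3, R 2, E 3] [E 3, R 2, R 3, R 2]"
| b5: "brrel [E 2, R 3, E 2] [Dl, E 2]"
| b6: "brrel [E 2, E 3, E 2] [Dl, E 2]"
| b7: "brrel [E 2, R 3, R 2] [E 2, R 3]"
| b8: "brrel [E 2, E 3, R 2] [E 2, E 3]"
| dinv1: "brrel [Dl, Di] []"
| dinv2: "brrel [Di, Dl] []"
| dcent: "brrel [Dl, x] [x, Dl]"

text \<open>The monoid congruence generated by the relations: brc u v means the words u and v
  denote the same element of BrM(F4) (equivalently, of Br(F4)).\<close>
inductive brc :: "letter list \<Rightarrow> letter list \<Rightarrow> bool" where
  ctx: "brrel u v \<Longrightarrow> brc (x @ u @ y) (x @ v @ y)"
| refl: "brc u u"
| sym: "brc u v \<Longrightarrow> brc v u"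
| trans: "brc u v \<Longrightarrow> brc v w \<Longrightarrow> brc u w"

definition dpow :: "int \<Rightarrow> letter list" where
  "dpow k = (if k \<ge> 0 then replicate (nat k) Dl else replicate (nat (- k)) Di)"

type_synonym vec = "real ^ 4"
type_synonym wel = "vec \<Rightarrow> vec"

definition v4 :: "real \<Rightarrow> real \<Rightarrow> real \<Rightarrow> real \<Rightarrow> vec" where
  "v4 a b c d = vector [a, b, c, d]"

definition refl :: "vec \<Rightarrow> wel" where
  "refl \<alpha> x = x - (2 * (x \<bullet> \<alpha>) / (\<alpha> \<bullet> \<alpha>)) *\<^sub>R \<alpha>"

definition beta :: "nat \<Rightarrow> vec" where
  "beta i = (if i = 1 then v4 (1/2) (-1/2) (-1/2) (-1/2)
             else if i = 2 then v4 0 1 0 0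
             else if i = 3 then v4 0 (-1) 1 0
             else v4 0 0 (-1) 1)"

definition rprod :: "vec list \<Rightarrow> wel" where
  "rprod as = foldr (\<lambda>\<alpha> f. refl \<alpha> \<circ> f) as id"

text \<open>Subgroup generated by the reflections in the given roots (reflections are
  involutions, so products of generators already form the subgroup).\<close>
definition gen :: "vec list \<Rightarrow> wel set" where
  "gen rs = {rprod as | as. set as \<subseteq> set rs}"

definition WF4 :: "wel set" where
  "WF4 = gen (map beta [1,2,3,4])"

definition wword :: "wel \<Rightarrow> nat list \<Rightarrow> bool" where
  "wword w ws \<longleftrightarrow> set ws \<subseteq> {1..4} \<and> rprod (map beta ws) = w"

definition wimg :: "wel \<Rightarrow> letter list \<Rightarrow> bool" where
  "wimg w x \<longleftrightarrow> (\<exists>ws. wword w ws \<and> x = map R ws)"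

text \<open>x is a word for e_beta = w e_j w^{-1}, where w beta_j = beta (up to sign, since a root
  and its negative are identified).\<close>
definition eroot :: "vec \<Rightarrow> letter list \<Rightarrow> bool" where
  "eroot b x \<longleftrightarrow> (\<exists>w j U V. j \<in> {1..4} \<and> w \<in> WF4 \<and> (w (beta j) = b \<or> w (beta j) = - b)
      \<and> wimg w U \<and> wimg (inv w) V \<and> x = U @ [E j] @ V)"

definition eX :: "vec list \<Rightarrow> letter list \<Rightarrow> bool" where
  "eX bs x \<longleftrightarrow> (\<exists>xs. list_all2 eroot bs xs \<and> x = concat xs)"

definition Xs :: "nat \<Rightarrow> vec list" where
  "Xs i = (if i = 0 then []
     else if i = 1 then [beta 4]
     else if i = 2 then [beta 1]
     else if i = 3 then [v4 0 (-1) 1 0, v4 0 1 1 0]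
     else if i = 4 then [beta 1, beta 3, v4 1 0 0 1]
     else [v4 0 (-1) 1 0, v4 0 1 1 0, v4 1 0 0 1, v4 (-1) 0 0 1])"

definition Ns :: "nat \<Rightarrow> wel set" where
  "Ns i = (if i = 0 then WF4
     else if i = 1 then gen [beta 1, beta 2, v4 0 0 1 1, beta 4]
     else if i = 2 then gen [beta 1, beta 3, beta 4, v4 (1/2) (1/2) (1/2) (-1/2)]
     else if i = 3 then gen [beta 2, beta 3, v4 0 0 0 1, v4 (-1) 0 0 1]
     else if i = 4 then gen [beta 3, beta 1, v4 (1/2) (1/2) (1/2) (-1/2), v4 (1/2) (-1/2) (1/2) (1/2)]
     else gen [beta 1, beta 2, beta 3, v4 0 0 0 1, v4 1 0 0 0])"

definition Cs :: "nat \<Rightarrow> wel set" where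
  "Cs i = (if i = 0 then WF4
     else if i = 1 then gen [beta 1, beta 2, v4 0 0 1 1]
     else if i = 2 then gen [beta 3, beta 4]
     else if i = 3 then gen [v4 (-1) 0 0 1]
     else {id})"

definition N6L :: "wel set" where "N6L = gen [beta 2, beta 3, v4 0 0 0 1, v4 (-1) 0 0 1]"
definition N6R :: "wel set" where "N6R = gen [beta 2, v4 0 0 1 0, v4 0 0 0 1, v4 (-1) 0 0 1]"
definition C6 :: "wel set" where "C6 = gen [v4 (-1) 0 0 1]"
definition N8 :: "wel set" where "N8 = gen [beta 2, beta 4, v4 1 0 0 0, v4 0 0 1 0]"

definition lcr :: "wel set \<Rightarrow> wel set \<Rightarrow> bool" where
  "lcr D N \<longleftrightarrow> D \<subseteq> WF4 \<and> (\<forall>x\<in>WF4. \<exists>!d. d \<in> D \<and> (\<exists>n\<in>N. x = d \<circ> n))"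

definition shape :: "wel set \<Rightarrow> letter list \<Rightarrow> wel set \<Rightarrow> wel set \<Rightarrow> letter list \<Rightarrow> bool" where
  "shape DL M C DR y \<longleftrightarrow> (\<exists>u\<in>DL. \<exists>v\<in>C. \<exists>d\<in>DR. \<exists>U V W.
      wimg u U \<and> wimg v V \<and> wimg (inv d) W \<and> y = U @ M @ V @ W)"

end

theory Submission
  imports Defs
begin

text \<open>
  Call \<open>M\<close> a middle word if it is one of the eleven monomials between the Weyl group
    factors in the list
  of shapes. It suffices that the set of all \<open>\<delta>\<^sup>k u M v\<close> with \<open>u,
    v \<in> W(F\<^sub>4)\<close> is closed under left
  multiplication by each \<open>e\<^sub>j\<close>. Since \<open>e\<^sub>j u = u
    e\<^sub>\<beta>\<close> with \<open>\<beta> = u\<^sup>-\<^sup>1 \<beta>\<^sub>j\<close>, only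
    the products \<open>e\<^sub>\<beta> M\<close> matter, and
  as every reflection \<open>n\<close> generating the left stabiliser \<open>N\<close> of
    \<open>M\<close> satisfies \<open>n M = M\<close> or \<open>n M = M n\<close>, it is
  enough to compute \<open>e\<^sub>\<beta> M\<close> for one root \<open>\<beta>\<close> in each
    \<open>N\<close>-orbit. Finally the Weyl group factors are cut
  down to coset representatives by moving the stabiliser parts through \<open>M\<close>. Elements
    of \<open>W(F\<^sub>4)\<close> enter
  only through freely chosen words, so the Coxeter presentation of \<open>W(F\<^sub>4)\<close> is
    never needed.
\<close>

section \<open>The monoid acting on itself by left multiplication\<close>

text \<open>The obstacle is computation: hundreds of concrete equations must be settled in a monoid
  known only by its presentation. Reading a word as a composition of left multiplications turns each
  of them into a goal for \<open>simp\<close>, with the relations and a selection of their critical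
  pairs as rewrite rules. In the closure argument the roots are mere indices 0 to 23. The table
  \<open>perm\<close> of the simple reflections acting on them is checked against the relations
  themselves, so no vector arithmetic occurs there; vectors enter only when reflection words are
  matched with the generators of the groups N. The tables of products, stabiliser words and orbit
  steps are certificates: however they were found, each entry is verified where it is used. Left
  multiplication suffices because a word is built by prepending letters. \<delta> is central and
  invertible, so its powers can be collected in front and cancelled.\<close>

lemma brc_append: "brc u v \<Longrightarrow> brc (x @ u @ y) (x @ v @ y)"
proof (induction rule: brc.induct)
  case (ctx u v x' y')
  then show ?case
    using brc.ctx[of u v "x @ x'" "y' @ y"] by simp
qed (auto intro: brc.intros)

lemma brc_Cons: "brc u v \<Longrightarrow> brc (l # u) (l # v)"
  using brc_append[of u v "[l]" "[]"] by simp

text \<open>Each generator acts on the monoid by left multiplication. Words then become nested applications,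
  so that the simplifier can rewrite with relations without any associativity rule.\<close>

quotient_type brm = "letter list" / brc
  by (intro equivpI reflpI sympI transpI) (blast intro: brc.intros)+

lift_definition act :: "letter \<Rightarrow> brm \<Rightarrow> brm" is Cons
  by (rule brc_Cons)

abbreviation ev :: "letter list \<Rightarrow> brm \<Rightarrow> brm" where
  "ev \<equiv> foldr act"

lemma ev_abs: "ev u (abs_brm v) = abs_brm (u @ v)"
  by (induction u) (auto simp: act.abs_eq)

text \<open>The left regular action is faithful: applied to the class of the empty word,
  \<open>ev u\<close> returns the class of \<open>u\<close>.\<close>

lemma brc_iff_ev: "brc u v \<longleftrightarrow> ev u = ev v"
proof
  assume "brc u v"
  have "ev u x = ev v x" for x
  proof (induction x rule: brm.abs_induct)
    case (1 y)
    then show ?case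
      using brc_append[OF \<open>brc u v\<close>, of "[]" y] by (simp add: ev_abs brm.abs_eq_iff)
  qed
  then show "ev u = ev v" by blast
next
  assume "ev u = ev v"
  then have "ev u (abs_brm []) = ev v (abs_brm [])" by simp
  then show "brc u v" by (simp add: ev_abs brm.abs_eq_iff)
qed

lemma brrel_ev: "brrel u v \<Longrightarrow> ev u x = ev v x"
  using brc.ctx[of u v "[]" "[]"] by (simp add: brc_iff_ev)

text \<open>Constants without a numeral argument keep the rewrite rules short and stable under the
  normalisation of 1 to \<open>Suc 0\<close>.\<close>

definition "r1 = act (R 1)"
definition "r2 = act (R 2)"
definition "r3 = act (R 3)"
definition "r4 = act (R 4)"
definition "e1 = act (E 1)"
definition "e2 = act (E 2)"
definition "e3 = act (E 3)"
definition "e4 = act (E 4)"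
definition "dl = act Dl"
definition "dli = act Di"

lemmas gens = r1_def r2_def r3_def r4_def e1_def e2_def e3_def e4_def dl_def dli_def

lemma dl_commute [simp]:
  "r1 (dl x) = dl (r1 x)" "r2 (dl x) = dl (r2 x)" "r3 (dl x) = dl (r3 x)" "r4 (dl x) = dl (r4 x)"
  "e1 (dl x) = dl (e1 x)" "e2 (dl x) = dl (e2 x)" "e3 (dl x) = dl (e3 x)" "e4 (dl x) = dl (e4 x)"
  by (simp_all add: gens brrel_ev[OF dcent, simplified])

lemma dl_dli [simp]: "dl (dli x) = x" "dli (dl x) = x"
  by (simp_all add: gens brrel_ev[OF dinv1, simplified] brrel_ev[OF dinv2, simplified])

text \<open>As a rewrite rule this cancels \<delta> from both sides of an equation between
  words.\<close>

lemma dl_inject [simp]: "dl x = dl y \<longleftrightarrow> x = y"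
  by (metis dl_dli(2))

section \<open>Rewrite rules for the generators\<close>

lemma
  shows r1r1 [simp]: "r1 (r1 x) = x"
    and r2r2 [simp]: "r2 (r2 x) = x"
    and r3r3 [simp]: "r3 (r3 x) = x"
    and r4r4 [simp]: "r4 (r4 x) = x"
  using brrel_ev[OF brrel.rr, of 1 x] brrel_ev[OF brrel.rr, of 2 x] brrel_ev[OF brrel.rr, of 3 x]
    brrel_ev[OF brrel.rr, of 4 x]
  by (simp_all add: gens)

lemma
  shows r1e1 [simp]: "r1 (e1 x) = e1 x"
    and r2e2 [simp]: "r2 (e2 x) = e2 x"
    and r3e3 [simp]: "r3 (e3 x) = e3 x"
    and r4e4 [simp]: "r4 (e4 x) = e4 x"
  using brrel_ev[OF brrel.re, of 1 x] brrel_ev[OF brrel.re, of 2 x] brrel_ev[OF brrel.re, of 3 x]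
    brrel_ev[OF brrel.re, of 4 x]
  by (simp_all add: gens)

lemma
  shows e1r1 [simp]: "e1 (r1 x) = e1 x"
    and e2r2 [simp]: "e2 (r2 x) = e2 x"
    and e3r3 [simp]: "e3 (r3 x) = e3 x"
    and e4r4 [simp]: "e4 (r4 x) = e4 x"
  using brrel_ev[OF brrel.er, of 1 x] brrel_ev[OF brrel.er, of 2 x] brrel_ev[OF brrel.er, of 3 x]
    brrel_ev[OF brrel.er, of 4 x]
  by (simp_all add: gens)

lemma
  shows e1e1 [simp]: "e1 (e1 x) = dl (dl (e1 x))"
    and e2e2 [simp]: "e2 (e2 x) = dl (dl (e2 x))"
  using brrel_ev[OF brrel.ee_long, of 1 x] brrel_ev[OF brrel.ee_long, of 2 x]
  by (simp_all add: gens)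

lemma
  shows e3e3 [simp]: "e3 (e3 x) = dl (e3 x)"
    and e4e4 [simp]: "e4 (e4 x) = dl (e4 x)"
  using brrel_ev[OF brrel.ee_short, of 3 x] brrel_ev[OF brrel.ee_short, of 4 x]
  by (simp_all add: gens)

lemma
  shows r1r3 [simp]: "r1 (r3 x) = r3 (r1 x)"
    and r1r4 [simp]: "r1 (r4 x) = r4 (r1 x)"
    and r2r4 [simp]: "r2 (r4 x) = r4 (r2 x)"
  using brrel_ev[OF brrel.comm_rr, of 1 3 x] brrel_ev[OF brrel.comm_rr, of 1 4 x]
    brrel_ev[OF brrel.comm_rr, of 2 4 x]
  by (simp_all add: gens)

lemma
  shows e1r3 [simp]: "e1 (r3 x) = r3 (e1 x)"
    and r1e3 [simp]: "r1 (e3 x) = e3 (r1 x)"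
    and e1r4 [simp]: "e1 (r4 x) = r4 (e1 x)"
    and r1e4 [simp]: "r1 (e4 x) = e4 (r1 x)"
    and e2r4 [simp]: "e2 (r4 x) = r4 (e2 x)"
    and r2e4 [simp]: "r2 (e4 x) = e4 (r2 x)"
  using brrel_ev[OF brrel.comm_er, of 1 3 x] brrel_ev[OF brrel.comm_er, of 3 1 x]
    brrel_ev[OF brrel.comm_er, of 1 4 x] brrel_ev[OF brrel.comm_er, of 4 1 x]
    brrel_ev[OF brrel.comm_er, of 2 4 x] brrel_ev[OF brrel.comm_er, of 4 2 x]
  by (simp_all add: gens)

lemma
  shows e3e1 [simp]: "e3 (e1 x) = e1 (e3 x)"
    and e4e1 [simp]: "e4 (e1 x) = e1 (e4 x)"
    and e2e4 [simp]: "e2 (e4 x) = e4 (e2 x)"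
  using brrel_ev[OF brrel.comm_ee, of 3 1 x] brrel_ev[OF brrel.comm_ee, of 4 1 x]
    brrel_ev[OF brrel.comm_ee, of 2 4 x]
  by (simp_all add: gens)

lemma
  shows e2r3e2 [simp]: "e2 (r3 (e2 x)) = dl (e2 x)"
  using brrel_ev[OF brrel.b5, of x]
  by (simp_all add: gens)

lemma
  shows e2e3e2 [simp]: "e2 (e3 (e2 x)) = dl (e2 x)"
  using brrel_ev[OF brrel.b6, of x]
  by (simp_all add: gens)

lemma
  shows r2r1e2 [simp]: "r2 (r1 (e2 x)) = e1 (e2 x)"
    and r1r2e1 [simp]: "r1 (r2 (e1 x)) = e2 (e1 x)"
    and r4r3e4 [simp]: "r4 (r3 (e4 x)) = e3 (e4 x)"
    and r3r4e3 [simp]: "r3 (r4 (e3 x)) = e4 (e3 x)"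
  using brrel_ev[OF brrel.a1, of 1 2 x] brrel_ev[OF brrel.a1, of 2 1 x]
    brrel_ev[OF brrel.a1, of 3 4 x] brrel_ev[OF brrel.a1, of 4 3 x]
  by (simp_all add: gens)

lemma
  shows r2r3e2 [simp]: "r2 (r3 (e2 x)) = r3 (e2 x)"
  using brrel_ev[OF brrel.b2, of x]
  by (simp_all add: gens)

lemma
  shows e2r3r2 [simp]: "e2 (r3 (r2 x)) = e2 (r3 x)"
  using brrel_ev[OF brrel.b7, of x]
  by (simp_all add: gens)

lemma
  shows e2e3r2 [simp]: "e2 (e3 (r2 x)) = e2 (e3 x)"
  using brrel_ev[OF brrel.b8, of x]
  by (simp_all add: gens)

lemma
  shows r2r1r2 [simp]: "r2 (r1 (r2 x)) = r1 (r2 (r1 x))"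
    and r3r4r3 [simp]: "r3 (r4 (r3 x)) = r4 (r3 (r4 x))"
  using brrel_ev[OF brrel.braid3, of 2 1 x] brrel_ev[OF brrel.braid3, of 3 4 x]
  by (simp_all add: gens)

lemma
  shows r2e1r2 [simp]: "r2 (e1 (r2 x)) = r1 (e2 (r1 x))"
    and r3e4r3 [simp]: "r3 (e4 (r3 x)) = r4 (e3 (r4 x))"
  using brrel_ev[OF brrel.a2, of 2 1 x] brrel_ev[OF brrel.a2, of 3 4 x]
  by (simp_all add: gens)

lemma
  shows r2e3r2e3 [simp]: "r2 (e3 (r2 (e3 x))) = e3 (e2 (e3 x))"
  using brrel_ev[OF brrel.b3, of x]
  by (simp_all add: gens)

lemma
  shows r2r3r2r3 [simp]: "r2 (r3 (r2 (r3 x))) = r3 (r2 (r3 (r2 x)))"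
  using brrel_ev[OF brrel.b1, of x]
  by (simp_all add: gens)

lemma
  shows r2r3r2e3 [simp]: "r2 (r3 (r2 (e3 x))) = e3 (r2 (r3 (r2 x)))"
  using brrel_ev[OF brrel.b4, of x]
  by (simp_all add: gens)

lemma r3e1e3 [simp]: "r3 (e1 (e3 x)) = e1 (e3 x)"
  using e1r3[of "e3 x"] unfolding r3e3[of x] by simp

text \<open>The next equations are part of a Knuth-Bendix completion of the relations: each one is the critical
  pair of the two equations cited, reduced to normal form.\<close>

lemma e1e3r1 [simp]: "e1 (e3 (r1 x)) = e1 (e3 x)"
  using e3e1[of "r1 x"] unfolding e1r1[of x] by simp

lemma e1e3r4 [simp]: "e1 (e3 (r4 x)) = e3 (r4 (e1 x))"
  using e3e1[of "r4 x"] unfolding e1r4[of x] by simp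

lemma e2r3r4e2 [simp]: "e2 (r3 (r4 (e2 x))) = dl (r4 (e2 x))"
  using e2r3e2[of "r4 x"] unfolding e2r4[of x] by simp

lemma r2e1e2 [simp]: "r2 (e1 (e2 x)) = r1 (e2 x)"
  using r2r2[of "r1 (e2 x)"] unfolding r2r1e2[of x] by simp

lemma r1e2e1 [simp]: "r1 (e2 (e1 x)) = r2 (e1 x)"
  using r1r1[of "r2 (e1 x)"] unfolding r1r2e1[of x] by simp

lemma r1r2r3e1 [simp]: "r1 (r2 (r3 (e1 x))) = e2 (r3 (e1 x))"
  using r1r2e1[of "r3 x"] unfolding e1r3[of x] by simp

lemma r4r2r3e4 [simp]: "r4 (r2 (r3 (e4 x))) = r2 (e3 (e4 x))"
  using r2r4[of "r3 (e4 x)"] unfolding r4r3e4[of x] by simp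

lemma r4e2r3e4 [simp]: "r4 (e2 (r3 (e4 x))) = e2 (e3 (e4 x))"
  using e2r4[of "r3 (e4 x)"] unfolding r4r3e4[of x] by simp

lemma e3r4e3 [simp]: "e3 (r4 (e3 x)) = e3 (e4 (e3 x))"
  using e3r3[of "r4 (e3 x)"] unfolding r3r4e3[of x] by simp

lemma r3r4e1e3 [simp]: "r3 (r4 (e1 (e3 x))) = e1 (e4 (e3 x))"
  using e1r3[of "r4 (e3 x)"] unfolding r3r4e3[of x] by simp

lemma r2r3r4e2 [simp]: "r2 (r3 (r4 (e2 x))) = r3 (r4 (e2 x))"
  using r2r3e2[of "r4 x"] unfolding e2r4[of x] by simp

lemma e2r3r4r2 [simp]: "e2 (r3 (r4 (r2 x))) = e2 (r3 (r4 x))"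
  using e2r3r2[of "r4 x"] unfolding r2r4[of x] by simp

lemma e2r3e1e2 [simp]: "e2 (r3 (e1 (e2 x))) = e2 (r3 (r1 (e2 x)))"
  using e2r3r2[of "r1 (e2 x)"] unfolding r2r1e2[of x] by simp

lemma e2e3r4r2 [simp]: "e2 (e3 (r4 (r2 x))) = e2 (e3 (r4 x))"
  using e2e3r2[of "r4 x"] unfolding r2r4[of x] by simp

lemma e2e3e4r2 [simp]: "e2 (e3 (e4 (r2 x))) = e2 (e3 (e4 x))"
  using e2e3r2[of "e4 x"] unfolding r2e4[of x] by simp

lemma e2e1e3e2 [simp]: "e2 (e1 (e3 (e2 x))) = e2 (e3 (r1 (e2 x)))"
  using e2e3r2[of "r1 (e2 x)"] unfolding r2r1e2[of x] by simp

lemma r1r2r3r1e2 [simp]: "r1 (r2 (r3 (r1 (e2 x)))) = r2 (r3 (r1 (e2 x)))"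
  using r2r1r2[of "r3 (e2 x)"] unfolding r2r3e2[of x] by simp

lemma e2r3r1r2r1 [simp]: "e2 (r3 (r1 (r2 (r1 x)))) = e2 (r3 (r1 (r2 x)))"
  using e2r3r2[of "r1 (r2 x)"] unfolding r2r1r2[of x] by simp

lemma e1e2r1 [simp]: "e1 (e2 (r1 x)) = e1 (r2 x)"
  using r2r2[of "e1 (r2 x)"] unfolding r2e1r2[of x] by simp

lemma r2e1e4r2 [simp]: "r2 (e1 (e4 (r2 x))) = e4 (r1 (e2 (r1 x)))"
  using r2e1r2[of "e4 x"] unfolding r2e4[of x] by simp

lemma e2e1r2 [simp]: "e2 (e1 (r2 x)) = e2 (r1 x)"
  using r1r2e1[of "r2 x"] unfolding r2e1r2[of x] by simp

lemma r1e2r3r1e2 [simp]: "r1 (e2 (r3 (r1 (e2 x)))) = r2 (r3 (e1 (e2 x)))"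
  using r2e1r2[of "r3 (e2 x)"] unfolding r2r3e2[of x] by simp

lemma e4e3r4 [simp]: "e4 (e3 (r4 x)) = e4 (r3 x)"
  using r3r3[of "e4 (r3 x)"] unfolding r3e4r3[of x] by simp

lemma e3e4r3 [simp]: "e3 (e4 (r3 x)) = e3 (r4 x)"
  using r4r3e4[of "r3 x"] unfolding r3e4r3[of x] by simp

text \<open>The Temperley-Lieb relation \<open>e1 e2 e1 = e1\<close> is absent from the
  presentation. It follows from two uses of \<open>a1\<close>:
  \<open>e1 e2 e1 = r2 r1 e2 e1 = r2 r2 e1\<close>.\<close>

lemma e1e2e1 [simp]: "e1 (e2 (e1 x)) = e1 x"
  using r2r1e2[of "e1 x"] unfolding r1e2e1[of x] by simp

lemma e1e3e2e1 [simp]: "e1 (e3 (e2 (e1 x))) = e1 (e3 x)"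
  using e3e1[of "e2 (e1 x)"] unfolding e1e2e1[of x] by simp

lemma r4e2e3e4 [simp]: "r4 (e2 (e3 (e4 x))) = e2 (r3 (e4 x))"
  using r4r4[of "e2 (r3 (e4 x))"] unfolding r4e2r3e4[of x] by simp

lemma e4e3e4 [simp]: "e4 (e3 (e4 x)) = e4 x"
  using e4e3r4[of "r3 (e4 x)"] unfolding r4r3e4[of x] by simp

lemma e3e4e3 [simp]: "e3 (e4 (e3 x)) = e3 x"
  using e3e4r3[of "r4 (e3 x)"] unfolding r3r4e3[of x] by simp

lemma e1r2r1 [simp]: "e1 (r2 (r1 x)) = e1 (e2 x)"
  using e1e2r1[of "r1 x"] unfolding r1r1[of x] by simp

lemma e2r1r2 [simp]: "e2 (r1 (r2 x)) = e2 (e1 x)"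
  using e2e1r2[of "r2 x"] unfolding r2r2[of x] by simp

lemma e4r3r4 [simp]: "e4 (r3 (r4 x)) = e4 (e3 x)"
  using e4e3r4[of "r4 x"] unfolding r4r4[of x] by simp

lemma e3r4r3 [simp]: "e3 (r4 (r3 x)) = e3 (e4 x)"
  using e3e4r3[of "r3 x"] unfolding r3r3[of x] by simp

lemma e1e2r3e1 [simp]: "e1 (e2 (r3 (e1 x))) = r3 (e1 x)"
  using e1e2e1[of "r3 x"] unfolding e1r3[of x] by simp

lemma e4e2e3e4 [simp]: "e4 (e2 (e3 (e4 x))) = e4 (e2 x)"
  using e2e4[of "e3 (e4 x)"] unfolding e4e3e4[of x] by simp

lemma e4r2e3e4 [simp]: "e4 (r2 (e3 (e4 x))) = e4 (r2 x)"
  using r2e4[of "e3 (e4 x)"] unfolding e4e3e4[of x] by simp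

lemma e1r2r3r1 [simp]: "e1 (r2 (r3 (r1 x))) = e1 (e2 (r3 x))"
  using e1r2r1[of "r3 x"] unfolding r1r3[of x] by simp

lemma e1e3r2r1 [simp]: "e1 (e3 (r2 (r1 x))) = e1 (e3 (e2 x))"
  using e3e1[of "r2 (r1 x)"] unfolding e1r2r1[of x] by simp

lemma e1r2e3r1 [simp]: "e1 (r2 (e3 (r1 x))) = e1 (e2 (e3 x))"
  using e1r2r1[of "e3 x"] unfolding r1e3[of x] by simp

lemma e4r2r3r4 [simp]: "e4 (r2 (r3 (r4 x))) = e4 (r2 (e3 x))"
  using r2e4[of "r3 (r4 x)"] unfolding e4r3r4[of x] by simp

lemma r2e3e2e3 [simp]: "r2 (e3 (e2 (e3 x))) = e3 (r2 (e3 x))"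
  using r2r2[of "e3 (r2 (e3 x))"] unfolding r2e3r2e3[of x] by simp

text \<open>From here on \<open>e3 e2 e3\<close> is the normal form of the middle word
  \<open>e3 r2 e3\<close> that belongs to X_3.\<close>

lemma e3r2e3 [simp]: "e3 (r2 (e3 x)) = e3 (e2 (e3 x))"
  using r2e3r2e3[of "r2 (e3 x)"] unfolding r2e3r2e3[of x] by simp

lemma e3r2e1e3 [simp]: "e3 (r2 (e1 (e3 x))) = e3 (e2 (e1 (e3 x)))"
  using e3r2e3[of "e1 x"] unfolding e3e1[of x] by simp

lemma r3r2r3r4r2e3 [simp]: "r3 (r2 (r3 (r4 (r2 (e3 x))))) = r2 (r3 (e4 (r2 (e3 x))))"
  using r2r3r2r3[of "r4 (e3 x)"] unfolding r3r4e3[of x] by simp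

lemma r1r2r3r1r2r3 [simp]: "r1 (r2 (r3 (r1 (r2 (r3 x))))) = r2 (r3 (r1 (r2 (r3 (r2 x)))))"
  using r2r1r2[of "r3 (r2 (r3 x))"] unfolding r2r3r2r3[of x] by simp

lemma r3r2r3r4r2r3 [simp]: "r3 (r2 (r3 (r4 (r2 (r3 x))))) = r2 (r3 (r4 (r2 (r3 (r4 x)))))"
  using r2r3r2r3[of "r4 (r3 x)"] unfolding r3r4r3[of x] by simp

lemma r3r2r3e4r2r3 [simp]: "r3 (r2 (r3 (e4 (r2 (r3 x))))) = r2 (r3 (r4 (r2 (e3 (r4 x)))))"
  using r2r3r2r3[of "e4 (r3 x)"] unfolding r3e4r3[of x] by simp

lemma r2e3r2r3r2 [simp]: "r2 (e3 (r2 (r3 (r2 x)))) = r3 (r2 (e3 x))"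
  using r2r2[of "r3 (r2 (e3 x))"] unfolding r2r3r2e3[of x] by simp

lemma e3r2r3r2e1 [simp]: "e3 (r2 (r3 (r2 (e1 x)))) = r2 (r3 (r2 (e1 (e3 x))))"
  using r2r3r2e3[of "e1 x"] unfolding e3e1[of x] by simp

lemma r1r2r3r1r2e3 [simp]: "r1 (r2 (r3 (r1 (r2 (e3 x))))) = r2 (e3 (r1 (r2 (r3 (r2 x)))))"
  using r2r1r2[of "r3 (r2 (e3 x))"] unfolding r2r3r2e3[of x] by simp

lemma e2e3r1r2r3r2 [simp]: "e2 (e3 (r1 (r2 (r3 (r2 x))))) = e2 (r3 (e1 (r2 (e3 x))))"
  using e2r1r2[of "r3 (r2 (e3 x))"] unfolding r2r3r2e3[of x] by simp

lemma e3r2r3r4r2r3 [simp]: "e3 (r2 (r3 (r4 (r2 (r3 x))))) = e3 (r2 (r3 (e4 (r2 x))))"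
  using r2r3r2e3[of "r4 (r3 x)"] unfolding e3r4r3[of x] by simp

lemma r4r1r2r3e4 [simp]: "r4 (r1 (r2 (r3 (e4 x)))) = r1 (r2 (e3 (e4 x)))"
  using r1r4[of "r2 (r3 (e4 x))"] unfolding r4r2r3e4[of x] by simp

lemma r4e1e2r3e4 [simp]: "r4 (e1 (e2 (r3 (e4 x)))) = e1 (e2 (e3 (e4 x)))"
  using e1r4[of "e2 (r3 (e4 x))"] unfolding r4e2r3e4[of x] by simp

text \<open>The middle word of form (IV) agrees with its own reversal, in accordance with
  \<open>N8\<close> serving on both of its sides.\<close>

lemma e4e3e2r3e4 [simp]: "e4 (e3 (e2 (r3 (e4 x)))) = e4 (r3 (e2 (e3 (e4 x))))"
  using e4r3r4[of "e2 (r3 (e4 x))"] unfolding r4e2r3e4[of x] by simp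

lemma e2r3r4r1r2r1 [simp]: "e2 (r3 (r4 (r1 (r2 (r1 x))))) = e2 (r3 (r4 (r1 (r2 x))))"
  using e2r3r4r2[of "r1 (r2 x)"] unfolding r2r1r2[of x] by simp

lemma r1e2e3r1e2 [simp]: "r1 (e2 (e3 (r1 (e2 x)))) = r2 (e1 (e3 (e2 x)))"
  using r1e2e1[of "e3 (e2 x)"] unfolding e2e1e3e2[of x] by simp

lemma r4r1e2e3e4 [simp]: "r4 (r1 (e2 (e3 (e4 x)))) = r1 (e2 (r3 (e4 x)))"
  using r1r4[of "e2 (e3 (e4 x))"] unfolding r4e2e3e4[of x] by simp

lemma e1e3e2e3r1 [simp]: "e1 (e3 (e2 (e3 (r1 x)))) = e1 (e3 (e2 (e3 x)))"
  using e3e1[of "r2 (e3 (r1 x))"] unfolding e1r2e3r1[of x] by simp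

lemma e4r1r2e3e4 [simp]: "e4 (r1 (r2 (e3 (e4 x)))) = e4 (r1 (r2 x))"
  using r1e4[of "r2 (e3 (e4 x))"] unfolding e4r2e3e4[of x] by simp

lemma e1e3r2r3r1 [simp]: "e1 (e3 (r2 (r3 (r1 x)))) = e1 (e3 (e2 (r3 x)))"
  using e3e1[of "r2 (r3 (r1 x))"] unfolding e1r2r3r1[of x] by simp

lemma e4r1r2r3r4 [simp]: "e4 (r1 (r2 (r3 (r4 x)))) = e4 (r1 (r2 (e3 x)))"
  using r1e4[of "r2 (r3 (r4 x))"] unfolding e4r2r3r4[of x] by simp

text \<open>Both sides of this critical pair carry a factor \<delta>, so its reduction uses the
  invertibility of \<delta> through \<open>dl_inject\<close>.\<close>

lemma r2e3e2 [simp]: "r2 (e3 (e2 x)) = e3 (e2 x)"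
  using r2e3e2e3[of "e2 x"] unfolding e2e3e2[of x] by simp

lemma e2e3r1e2e3r1 [simp]: "e2 (e3 (r1 (e2 (e3 (r1 x))))) = e2 (e3 (r1 (e2 (e3 x))))"
  using e2e1e3e2[of "e3 (r1 x)"] unfolding e1e3e2e3r1[of x] by simp

lemma r2e3r2r3 [simp]: "r2 (e3 (r2 (r3 x))) = r3 (r2 (e3 (r2 x)))"
  using r2e3r2r3r2[of "r2 x"] unfolding r2r2[of x] by simp

lemma r1r2e3r1r2r3 [simp]: "r1 (r2 (e3 (r1 (r2 (r3 x))))) = r2 (r3 (r1 (r2 (e3 (r2 x)))))"
  using r2r1r2[of "e3 (r2 (r3 x))"] unfolding r2e3r2r3[of x] by simp

lemma r1e2e3r1r2r3 [simp]: "r1 (e2 (e3 (r1 (r2 (r3 x))))) = r2 (r3 (e1 (r2 (e3 (r2 x)))))"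
  using r2e1r2[of "e3 (r2 (r3 x))"] unfolding r2e3r2r3[of x] by simp

lemma r3r2e3r4r2r3 [simp]: "r3 (r2 (e3 (r4 (r2 (r3 x))))) = r2 (e3 (r4 (r2 (r3 (r4 x)))))"
  using r2e3r2r3[of "r4 (r3 x)"] unfolding r3r4r3[of x] by simp

lemma e1e3e2e3r4r1 [simp]: "e1 (e3 (e2 (e3 (r4 (r1 x))))) = e1 (e3 (e2 (e3 (r4 x))))"
  using e1e3e2e3r1[of "r4 x"] unfolding r1r4[of x] by simp

lemma e1e3r2r3e4r1 [simp]: "e1 (e3 (r2 (r3 (e4 (r1 x))))) = e1 (e3 (e2 (r3 (e4 x))))"
  using e1e3r2r3r1[of "e4 x"] unfolding r1e4[of x] by simp

lemma r3r4r2r3r4r2e1e3 [simp]: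
  "r3 (r4 (r2 (r3 (r4 (r2 (e1 (e3 x))))))) = r4 (r2 (e3 (r4 (r2 (e1 (e3 x))))))"
  using r3r2r3r4r2e3[of "r2 (r3 (r2 (e1 x)))"] unfolding e3r2r3r2e1[of x] by simp

lemma r3r1r2r3r4r2r3 [simp]:
  "r3 (r1 (r2 (r3 (r4 (r2 (r3 x)))))) = r1 (r2 (r3 (r4 (r2 (r3 (r4 x))))))"
  using r1r3[of "r2 (r3 (r4 (r2 (r3 x))))"] unfolding r3r2r3r4r2r3[of x] by simp

lemma r3e1r2r3r4r2r3 [simp]:
  "r3 (e1 (r2 (r3 (r4 (r2 (r3 x)))))) = e1 (r2 (r3 (r4 (r2 (r3 (r4 x))))))"
  using e1r3[of "r2 (r3 (r4 (r2 (r3 x))))"] unfolding r3r2r3r4r2r3[of x] by simp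

lemma r2r3r4r2e3r4r2r3 [simp]:
  "r2 (r3 (r4 (r2 (e3 (r4 (r2 (r3 x))))))) = r3 (r4 (r2 (e3 (r4 (r2 (r3 (r2 x)))))))"
  using r3r2r3e4r2r3[of "r2 (r3 x)"] unfolding r2r3r2r3[of x] by simp

lemma e2r3r4r1r2r3r1 [simp]: "e2 (r3 (r4 (r1 (r2 (r3 (r1 x)))))) = e2 (r3 (r4 (r1 (r2 (r3 x)))))"
  using e2r3r4r1r2r1[of "r3 x"] unfolding r1r3[of x] by simp

lemma r4r3r4r2e3r4r2r3 [simp]:
  "r4 (r3 (r4 (r2 (e3 (r4 (r2 (r3 x))))))) = r3 (r4 (r2 (e3 (r4 (r2 (r3 (r4 x)))))))"
  using r3r4r3[of "r2 (e3 (r4 (r2 (r3 x))))"] unfolding r3r2e3r4r2r3[of x] by simp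

lemma r3r2r3r1e2r3r4r1r2r3 [simp]:
  "r3 (r2 (r3 (r1 (e2 (r3 (r4 (r1 (r2 (r3 x))))))))) =
    r2 (r3 (r1 (e2 (r3 (r4 (r1 (r2 (r3 (r4 x)))))))))"
  using r2r3r2r3[of "e1 (r2 (r3 (r4 (r2 (r3 x)))))"] unfolding r3e1r2r3r4r2r3[of x] by simp

lemma r4r3r4r1r2e3r4r2r3 [simp]:
  "r4 (r3 (r4 (r1 (r2 (e3 (r4 (r2 (r3 x)))))))) = r3 (r4 (r1 (r2 (e3 (r4 (r2 (r3 (r4 x))))))))"
  using r1r4[of "r3 (r4 (r2 (e3 (r4 (r2 (r3 x))))))"] unfolding r4r3r4r2e3r4r2r3[of x] by simp

lemma r1r2r3r4r1r2e3r4r2r3 [simp]: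
  "r1 (r2 (r3 (r4 (r1 (r2 (e3 (r4 (r2 (r3 x))))))))) =
    r2 (r3 (r4 (r1 (r2 (e3 (r4 (r2 (r3 (r2 x)))))))))"
  using r2r1r2[of "r3 (r4 (r2 (e3 (r4 (r2 (r3 x))))))"] unfolding r2r3r4r2e3r4r2r3[of x] by simp

lemma r4r2r3r4r1r2e3r4r2r3 [simp]:
  "r4 (r2 (r3 (r4 (r1 (r2 (e3 (r4 (r2 (r3 x))))))))) =
    r2 (r3 (r4 (r1 (r2 (e3 (r4 (r2 (r3 (r4 x)))))))))"
  using r2r4[of "r3 (r4 (r1 (r2 (e3 (r4 (r2 (r3 x)))))))"] unfolding r4r3r4r1r2e3r4r2r3[of x] by
    simp

lemma r4r3r4r2r3r1e2r3r4r1r2r3 [simp]: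
  "r4 (r3 (r4 (r2 (r3 (r1 (e2 (r3 (r4 (r1 (r2 (r3 x))))))))))) =
    r3 (r4 (r2 (r3 (r1 (e2 (r3 (r4 (r1 (r2 (r3 (r4 x)))))))))))"
  using r3r4r3[of "r2 (r3 (r1 (e2 (r3 (r4 (r1 (r2 (r3 x))))))))"] unfolding
    r3r2r3r1e2r3r4r1r2r3[of x] by simp

lemma r4r2r3r4r2r3r1e2r3r4r1r2r3 [simp]:
  "r4 (r2 (r3 (r4 (r2 (r3 (r1 (e2 (r3 (r4 (r1 (r2 (r3 x)))))))))))) =
    r2 (r3 (r4 (r2 (r3 (r1 (e2 (r3 (r4 (r1 (r2 (r3 (r4 x))))))))))))"
  using r2r4[of "r3 (r4 (r2 (r3 (r1 (e2 (r3 (r4 (r1 (r2 (r3 x))))))))))"] unfolding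
    r4r3r4r2r3r1e2r3r4r1r2r3[of x] by simp

text \<open>Applied to \<open>r2 (r1 y)\<close>, this moves \<open>r4\<close> past the root element
  of \<epsilon>_1 (index 22), as it must since \<epsilon>_1 is orthogonal to \<beta>_4.\<close>

lemma r4r1r2r3r4r2r3r1e2r3r4r1r2r3 [simp]:
  "r4 (r1 (r2 (r3 (r4 (r2 (r3 (r1 (e2 (r3 (r4 (r1 (r2 (r3 x))))))))))))) =
    r1 (r2 (r3 (r4 (r2 (r3 (r1 (e2 (r3 (r4 (r1 (r2 (r3 (r4 x)))))))))))))"
  using r1r4[of "r2 (r3 (r4 (r2 (r3 (r1 (e2 (r3 (r4 (r1 (r2 (r3 x)))))))))))"] unfolding
    r4r2r3r4r2r3r1e2r3r4r1r2r3[of x] by simp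

text \<open>The index 1 appears as \<open>Suc 0\<close> because the simplifier has already rewritten
  it when these rules are tried.\<close>

lemma act_fold [simp]:
  "act (R (Suc 0)) = r1" "act (R 2) = r2" "act (R 3) = r3" "act (R 4) = r4"
  "act (E (Suc 0)) = e1" "act (E 2) = e2" "act (E 3) = e3" "act (E 4) = e4"
  "act Dl = dl" "act Di = dli"
  by (simp_all add: gens)

section \<open>The root elements and their products with the middle words\<close>

text \<open>The words \<^term>\<open>eword k\<close> represent the 24 elements \<open>e\<^sub>\<beta>\<close>, and row \<^term>\<open>perm i\<close> records how
  \<^term>\<open>refl (beta i)\<close> permutes the positive roots \<open>\<beta>\<close> in this
    numbering.\<close>

definition eword :: "nat \<Rightarrow> letter list" where
  "eword k =
    [[E 1], [E 2], [E 3], [E 4], [R 2, E 1, R 2], [R 3, E 2, R 3], [R 2, E 3, R 2], [R 4, E 3, R 4],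
     [R 3, R 2, E 1, R 2, R 3], [R 4, R 3, E 2, R 3, R 4], [R 1, R 2, E 3, R 2, R 1],
     [R 4, R 2, E 3, R 2, R 4], [R 2, R 3, R 2, E 1, R 2, R 3, R 2],
     [R 4, R 3, R 2, E 1, R 2, R 3, R 4], [R 4, R 1, R 2, E 3, R 2, R 1, R 4],
     [R 3, R 4, R 2, E 3, R 2, R 4, R 3], [R 4, R 2, R 3, R 2, E 1, R 2, R 3, R 2, R 4],
     [R 3, R 4, R 1, R 2, E 3, R 2, R 1, R 4, R 3],
     [R 3, R 4, R 2, R 3, R 2, E 1, R 2, R 3, R 2, R 4, R 3],
     [R 2, R 3, R 4, R 1, R 2, E 3, R 2, R 1, R 4, R 3, R 2],
     [R 2, R 3, R 4, R 2, R 3, R 2, E 1, R 2, R 3, R 2, R 4, R 3, R 2],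
     [R 3, R 2, R 3, R 4, R 1, R 2, E 3, R 2, R 1, R 4, R 3, R 2, R 3],
     [R 1, R 2, R 3, R 4, R 2, R 3, R 2, E 1, R 2, R 3, R 2, R 4, R 3, R 2, R 1],
     [R 4, R 3, R 2, R 3, R 4, R 1, R 2, E 3, R 2, R 1, R 4, R 3, R 2, R 3, R 4]] ! k"

definition perm :: "nat \<Rightarrow> nat list" where
  "perm i =
    (if i = 1 then [0, 4, 2, 3, 1, 8, 10, 7, 5, 13, 6, 14, 12, 9, 11, 17, 16, 15, 18, 19, 22, 21,
      20, 23]
     else if i = 2 then [4, 1, 6, 3, 0, 5, 2, 11, 12, 9, 10, 7, 8, 16, 14, 15, 13, 19, 20, 17,
       18, 21, 22, 23]
     else if i = 3 then [0, 5, 2, 7, 8, 1, 6, 3, 4, 9, 10, 15, 12, 13, 17, 11, 18, 14, 16, 21,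
       20, 19, 22, 23]
     else [0, 1, 7, 3, 4, 9, 11, 2, 13, 5, 14, 6, 16, 8, 10, 15, 12, 17, 18, 19, 20, 23, 22, 21])"

text \<open>The 96 cases are decided by rewriting in the monoid. They validate the table
  \<open>perm\<close>, so that afterwards conjugation of root elements is a computation with
  indices.\<close>

lemma eword_conj:
  assumes "i \<in> {1..4}" "k < 24"
  shows "ev (R i # eword k @ [R i]) = ev (eword (perm i ! k))"
proof
  fix x
  have "i \<in> {1, 2, 3, 4}" "k \<in> set [0..<24]"
    using assms by auto
  then show "ev (R i # eword k @ [R i]) x = ev (eword (perm i ! k)) x"
    by (elim insertE emptyE; simp add: upt_rec; elim disjE; simp add: eword_def perm_def)
qed

text \<open>Up to powers of \<open>\<delta>\<close>, the fourth to sixth words below are \<open>e\<^sub>X\<close> for \<open>X = X\<^sub>3, X\<^sub>4, X\<^sub>5\<close>.\<close>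

definition mids :: "letter list set" where
  "mids = {[], [E 4], [E 1], [E 3, R 2, E 3], [E 1, E 3], [E 3, R 2, R 1, E 3, R 2, E 3],
    [E 3, E 2],
    [E 2, E 3], [E 4, R 3, E 2, E 3, E 4], [E 3, E 2, E 1, E 3], [E 3, E 1, E 2, E 3]}"

definition reducible :: "nat \<Rightarrow> letter list \<Rightarrow> nat \<Rightarrow> nat list
  \<Rightarrow> letter list \<Rightarrow> nat list \<Rightarrow> bool" where
  "reducible k M s U M' V \<longleftrightarrow> M' \<in> mids \<and> set U \<subseteq> {1..4}
    \<and> set V \<subseteq> {1..4} \<and>
     (\<forall>x. ev (eword k @ M) x = (dl ^^ s) (ev (map R U @ M' @ map R V) x))"

lemma reducibleI:
  assumes "M' \<in> mids" "set U \<subseteq> {1..4}" "set V \<subseteq> {1..4}"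
    and "\<And>x. ev (eword k @ M) x = (dl ^^ s) (ev (map R U @ M' @ map R V) x)"
  shows "reducible k M s U M' V"
  using assms unfolding reducible_def by blast

lemma funpow_2: "(f ^^ 2) x = f (f x)"
  by (simp add: numeral_2_eq_2)

section \<open>Products of root elements with the eleven middle words\<close>

lemma products_e4:
  "reducible 0 [E 4] 0 [3, 4] [E 1, E 3] [4, 3]"
  "reducible 2 [E 4] 0 [4, 3] [E 4] []"
  "reducible 3 [E 4] 1 [] [E 4] []"
  "reducible 5 [E 4] 0 [3, 4] [E 2, E 3] [4, 3]"
  "reducible 15 [E 4] 0 [3, 4] [E 3, R 2, E 3] [4, 3]"
  by (rule reducibleI; simp add: eword_def mids_def funpow_2)+

lemma products_e1:
  "reducible 0 [E 1] 2 [] [E 1] []"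
  "reducible 1 [E 1] 0 [1, 2] [E 1] []"
  "reducible 2 [E 1] 0 [] [E 1, E 3] []"
  "reducible 6 [E 1] 0 [2, 1] [E 3, E 2] [1, 2]"
  "reducible 12 [E 1] 1 [2, 3, 2] [E 1] []"
  by (rule reducibleI; simp add: eword_def mids_def funpow_2)+

text \<open>Index 10 belongs to \<epsilon>_4 - \<epsilon>_1, which is orthogonal to both roots of
  X_3. Its product with this word is the middle word for X_5, which therefore needs only three of
  the four roots of X_5.\<close>

lemma products_e3r2e3:
  "reducible 0 [E 3, R 2, E 3] 0 [] [E 3, E 1, E 2, E 3] []"
  "reducible 1 [E 3, R 2, E 3] 1 [] [E 2, E 3] []"
  "reducible 2 [E 3, R 2, E 3] 1 [] [E 3, R 2, E 3] []"
  "reducible 3 [E 3, R 2, E 3] 0 [3, 4] [E 3, R 2, E 3] []"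
  "reducible 9 [E 3, R 2, E 3] 1 [4, 3, 1, 2, 3, 4] [E 1, E 3] [4, 3, 2, 1, 3, 4]"
  "reducible 10 [E 3, R 2, E 3] 0 [] [E 3, R 2, R 1, E 3, R 2, E 3] []"
  by (rule reducibleI; simp add: eword_def mids_def funpow_2)+

lemma products_e1e3:
  "reducible 0 [E 1, E 3] 2 [] [E 1, E 3] []"
  "reducible 1 [E 1, E 3] 0 [1, 2] [E 1, E 3] []"
  "reducible 2 [E 1, E 3] 1 [] [E 1, E 3] []"
  "reducible 3 [E 1, E 3] 0 [3, 4] [E 1, E 3] []"
  "reducible 6 [E 1, E 3] 0 [] [E 3, E 2, E 1, E 3] []"
  "reducible 11 [E 1, E 3] 0 [3, 2, 3, 4, 3, 2] [E 1, E 3] []"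
  "reducible 12 [E 1, E 3] 1 [2, 3, 2] [E 1, E 3] []"
  "reducible 16 [E 1, E 3] 1 [2, 3, 4, 3, 2] [E 1, E 3] []"
  by (rule reducibleI; simp add: eword_def mids_def funpow_2)+

lemma products_e3r2r1e3r2e3:
  "reducible 0 [E 3, R 2, R 1, E 3, R 2, E 3] 1 [] [E 3, E 1, E 2, E 3] []"
  "reducible 2 [E 3, R 2, R 1, E 3, R 2, E 3] 1 [] [E 3, R 2, R 1, E 3, R 2, E 3] []"
  "reducible 3 [E 3, R 2, R 1, E 3, R 2, E 3] 0 [3, 4] [E 3, R 2, R 1, E 3, R 2, E 3] []"
  by (rule reducibleI; simp add: eword_def mids_def funpow_2)+

lemma products_e3e2:
  "reducible 0 [E 3, E 2] 0 [] [E 1, E 3] [2, 1]"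
  "reducible 1 [E 3, E 2] 1 [1, 2] [E 1] [2, 1]"
  "reducible 2 [E 3, E 2] 1 [] [E 3, E 2] []"
  "reducible 3 [E 3, E 2] 0 [3, 4] [E 3, E 2] []"
  "reducible 9 [E 3, E 2] 1 [4, 3, 1, 2, 3, 4] [E 1, E 3] [4, 3, 2, 1]"
  "reducible 10 [E 3, E 2] 0 [] [E 3, E 2, E 1, E 3] [2, 1]"
  by (rule reducibleI; simp add: eword_def mids_def funpow_2)+

lemma products_e2e3:
  "reducible 0 [E 2, E 3] 0 [2, 1] [E 2, E 3] []"
  "reducible 1 [E 2, E 3] 2 [] [E 2, E 3] []"
  "reducible 2 [E 2, E 3] 0 [] [E 3, R 2, E 3] []"
  "reducible 3 [E 2, E 3] 0 [1, 2, 3, 4] [E 1, E 3] [4, 3, 2, 1, 3, 4]"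
  "reducible 5 [E 2, E 3] 1 [3] [E 2, E 3] []"
  "reducible 7 [E 2, E 3] 0 [3] [E 4, R 3, E 2, E 3, E 4] [3, 4]"
  "reducible 9 [E 2, E 3] 1 [3, 4, 3] [E 2, E 3] []"
  "reducible 10 [E 2, E 3] 0 [1, 2] [E 3, E 1, E 2, E 3] []"
  by (rule reducibleI; simp add: eword_def mids_def funpow_2)+

lemma products_e4r3e2e3e4:
  "reducible 0 [E 4, R 3, E 2, E 3, E 4] 0 [3, 4] [E 1, E 3] [2, 3, 2, 4, 3, 2, 1]"
  "reducible 1 [E 4, R 3, E 2, E 3, E 4] 1 [1, 2, 3, 4] [E 1, E 3] [4, 3, 2, 1]"
  "reducible 2 [E 4, R 3, E 2, E 3, E 4] 0 [4, 3] [E 4, R 3, E 2, E 3, E 4] []"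
  "reducible 3 [E 4, R 3, E 2, E 3, E 4] 1 [] [E 4, R 3, E 2, E 3, E 4] []"
  "reducible 5 [E 4, R 3, E 2, E 3, E 4] 1 [3] [E 2, E 3] [4, 3]"
  "reducible 10 [E 4, R 3, E 2, E 3, E 4] 0 [4, 1, 2, 3, 2, 1] [E 4, R 3, E 2, E 3, E 4] []"
  "reducible 17 [E 4, R 3, E 2, E 3, E 4] 0 [3, 4] [E 3, E 2, E 1, E 3] [2, 3, 2, 4, 3, 2, 1]"
  "reducible 22 [E 4, R 3, E 2, E 3, E 4] 1 [1, 2, 3, 4, 2, 3, 2] [E 3, E 1, E 2, E 3] [4, 3]"
  by (rule reducibleI; simp add: eword_def mids_def funpow_2)+

lemma products_e3e2e1e3:
  "reducible 0 [E 3, E 2, E 1, E 3] 1 [] [E 1, E 3] []"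
  "reducible 2 [E 3, E 2, E 1, E 3] 1 [] [E 3, E 2, E 1, E 3] []"
  "reducible 3 [E 3, E 2, E 1, E 3] 0 [3, 4] [E 3, E 2, E 1, E 3] []"
  by (rule reducibleI; simp add: eword_def mids_def funpow_2)+

lemma products_e3e1e2e3:
  "reducible 0 [E 3, E 1, E 2, E 3] 2 [] [E 3, E 1, E 2, E 3] []"
  "reducible 1 [E 3, E 1, E 2, E 3] 0 [1, 2] [E 3, E 1, E 2, E 3] []"
  "reducible 2 [E 3, E 1, E 2, E 3] 1 [] [E 3, E 1, E 2, E 3] []"
  "reducible 3 [E 3, E 1, E 2, E 3] 0 [3, 4] [E 3, E 1, E 2, E 3] []"
  "reducible 6 [E 3, E 1, E 2, E 3] 0 [] [E 3, R 2, R 1, E 3, R 2, E 3] []"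
  "reducible 11 [E 3, E 1, E 2, E 3] 0 [3, 2, 3, 4, 3, 2] [E 3, E 1, E 2, E 3] []"
  "reducible 12 [E 3, E 1, E 2, E 3] 1 [2, 3, 2] [E 3, E 1, E 2, E 3] []"
  "reducible 16 [E 3, E 1, E 2, E 3] 1 [2, 3, 4, 3, 2] [E 3, E 1, E 2, E 3] []"
  by (rule reducibleI; simp add: eword_def mids_def funpow_2)+

text \<open>With the empty middle word the whole Weyl group acts, with one orbit of roots for each
  length: \<beta>_1 is short and \<beta>_4 is long.\<close>

lemma products_one:
  "reducible 0 [] 0 [] [E 1] []"
  "reducible 3 [] 0 [] [E 4] []"
  by (rule reducibleI; simp add: eword_def mids_def funpow_2)+

section \<open>Closure of the normal forms under multiplication\<close>

lemma act_dpow: "act l (ev (dpow k) x) = ev (dpow k) (act l x)"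
proof -
  have Dl: "act l (dl x) = dl (act l x)" for x
    using brrel_ev[OF dcent, of l x] by simp
  \<comment> \<open>The relation \<open>dcent\<close> speaks of \<open>Dl\<close> only; that its
    inverse is central follows by cancelling.\<close>
  have Di: "act l (dli x) = dli (act l x)" for x
    using Dl[of "dli x"] by (metis dl_dli)
  have "act l ((dl ^^ n) x) = (dl ^^ n) (act l x)" "act l ((dli ^^ n) x) = (dli ^^ n) (act l x)"
    for n
    by (induction n) (simp_all add: Dl Di)
  then show ?thesis
    by (simp add: dpow_def)
qed

lemma ev_dpow: "ev w (ev (dpow k) x) = ev (dpow k) (ev w x)"
  by (induction w) (simp_all add: act_dpow)

lemma dl_dpow: "dl (ev (dpow k) x) = ev (dpow (k + 1)) x"
proof (cases "k \<ge> 0")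
  case True
  then show ?thesis by (simp add: dpow_def nat_add_distrib)
next
  case False
  then have "nat (- k) = Suc (nat (- (k + 1)))" by simp
  with False show ?thesis by (simp add: dpow_def)
qed

lemma dli_dpow: "dli (ev (dpow k) x) = ev (dpow (k - 1)) x"
  using dl_dpow[of "k - 1" x] by (metis diff_add_cancel dl_dli(2))

lemma funpow_dl_dpow: "(dl ^^ s) (ev (dpow k) x) = ev (dpow (k + int s)) x"
  by (induction s) (simp_all add: dl_dpow add_ac)

lemma funpow_dli_dpow: "(dli ^^ s) (ev (dpow k) x) = ev (dpow (k - int s)) x"
  by (induction s) (simp_all add: dli_dpow algebra_simps)

lemma dpow_add: "ev (dpow j) (ev (dpow k) x) = ev (dpow (j + k)) x"
proof (cases "j \<ge> 0")
  case True
  then show ?thesis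
    using funpow_dl_dpow[of "nat j" k x] by (simp add: dpow_def[of j] add.commute)
next
  case False
  then show ?thesis
    using funpow_dli_dpow[of "nat (- j)" k x] by (simp add: dpow_def[of j] add.commute)
qed

lemma dpow_0 [simp]: "dpow 0 = []"
  by (simp add: dpow_def)

text \<open>The outer factors are index lists, not group elements: multiplying them is
  concatenation, and no two words for the same group element are ever compared.\<close>

definition nf :: "letter list \<Rightarrow> bool" where
  "nf a \<longleftrightarrow> (\<exists>k U M V. M \<in> mids \<and> set U \<subseteq> {1..4}
    \<and> set V \<subseteq> {1..4} \<and>
     ev a = ev (dpow k @ map R U @ M @ map R V))"

lemma nf_cong: "ev a = ev b \<Longrightarrow> nf a \<longleftrightarrow> nf b"
  by (simp add: nf_def)

lemma nf_conj:
  assumes "nf a" "set U \<subseteq> {1..4}" "set V \<subseteq> {1..4}"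
  shows "nf (map R U @ a @ map R V)"
proof -
  obtain k U' M V' where M: "M \<in> mids" "set U' \<subseteq> {1..4}" "set V' \<subseteq> {1..4}"
    "ev a = ev (dpow k @ map R U' @ M @ map R V')"
    using assms(1) unfolding nf_def by blast
  then have "ev (map R U @ a @ map R V) = ev (dpow k @ map R (U @ U') @ M @ map R (V' @ V))"
    by (simp add: fun_eq_iff ev_dpow)
  moreover have "set (U @ U') \<subseteq> {1..4}" "set (V' @ V) \<subseteq> {1..4}"
    using assms M by auto
  ultimately show ?thesis
    unfolding nf_def using M(1) by blast
qed

lemma nf_Dl: "nf a \<Longrightarrow> nf (Dl # a)" and nf_Di: "nf a \<Longrightarrow> nf (Di # a)"
proof -
  assume "nf a"
  then obtain k U' M V' where M: "M \<in> mids" "set U' \<subseteq> {1..4}" "set V' \<subseteq>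
    {1..4}"
    "ev a = ev (dpow k @ map R U' @ M @ map R V')"
    unfolding nf_def by blast
  have "ev (Dl # a) = ev (dpow (k + 1) @ map R U' @ M @ map R V')"
    "ev (Di # a) = ev (dpow (k - 1) @ map R U' @ M @ map R V')"
    using M(4) by (simp_all add: fun_eq_iff dl_dpow dli_dpow)
  then show "nf (Dl # a)" "nf (Di # a)"
    unfolding nf_def using M(1-3) by blast+
qed

lemma nf_reducible: "reducible k M s U M' V \<Longrightarrow> nf (eword k @ M)"
  unfolding reducible_def nf_def
  by (intro exI[of _ "int s"] exI[of _ U] exI[of _ M'] exI[of _ V])
    (use funpow_dl_dpow[of s 0] in \<open>auto simp: fun_eq_iff\<close>)

section \<open>Conjugation of root elements and orbits of roots\<close>

abbreviation move :: "nat list \<Rightarrow> nat \<Rightarrow> nat" where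
  "move \<equiv> foldr (\<lambda>i k. perm i ! k)"

lemma perm_less:
  assumes "k < 24"
  shows "perm i ! k < 24"
proof -
  \<comment> \<open>Every \<open>i\<close> other than 1, 2, 3 selects the last row of the table, so
    the bound is uniform in \<open>i\<close>.\<close>
  have "\<forall>k\<in>set (perm i). k < 24"
    by (simp add: perm_def)
  moreover have "length (perm i) = 24"
    by (simp add: perm_def)
  with assms have "perm i ! k \<in> set (perm i)"
    by (simp add: nth_mem)
  ultimately show ?thesis by (rule bspec)
qed

lemma move_less: "k < 24 \<Longrightarrow> move n k < 24"
  by (induction n) (simp_all add: perm_less)

lemma eword_move:
  assumes "set n \<subseteq> {1..4}" "k < 24"
  shows "ev (map R n @ eword k @ map R (rev n)) = ev (eword (move n k))"
  using assms(1)
proof (induction n)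
  case (Cons i n)
  then have "ev (map R (i # n) @ eword k @ map R (rev (i # n))) = ev (R i # eword (move n k) @
    [R i])"
    by (auto simp: fun_eq_iff)
  also have "\<dots> = ev (eword (move (i # n) k))"
    using eword_conj[of i "move n k"] move_less[OF assms(2)] Cons.prems by simp
  finally show ?case .
qed simp

lemma R_cancel: "set n \<subseteq> {1..4} \<Longrightarrow> ev (map R (rev n)) (ev (map R n) x) = x"
proof (induction n arbitrary: x)
  case (Cons i n)
  then have "act (R i) (act (R i) y) = y" for y
    using brrel_ev[OF brrel.rr[of i], of y] by simp
  with Cons show ?case by simp
qed simp

definition absorbs_left :: "nat list \<Rightarrow> letter list \<Rightarrow> bool" where
  "absorbs_left n M \<longleftrightarrow> (\<forall>x. ev (map R n @ M) x = ev M x)"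

definition absorbs_right :: "nat list \<Rightarrow> letter list \<Rightarrow> bool" where
  "absorbs_right n M \<longleftrightarrow> (\<forall>x. ev (M @ map R n) x = ev M x)"

definition commutes :: "nat list \<Rightarrow> letter list \<Rightarrow> bool" where
  "commutes n M \<longleftrightarrow> (\<forall>x. ev (map R n @ M) x = ev (M @ map R n) x)"

text \<open>The words for reflections are palindromes, being conjugates of a single letter. A
  palindrome is its own inverse, so conjugation by \<open>n\<close> puts the same word on both
  sides.\<close>

definition slides :: "letter list \<Rightarrow> nat list \<Rightarrow> bool" where
  "slides M n \<longleftrightarrow> set n \<subseteq> {1..4} \<and> rev n = n \<and>
    (absorbs_left n M \<or> commutes n M)"

lemma absorbs_leftI: "(\<And>x. ev (map R n @ M) x = ev M x) \<Longrightarrow> absorbs_left n M"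
  and absorbs_rightI: "(\<And>x. ev (M @ map R n) x = ev M x) \<Longrightarrow> absorbs_right n M"
  and commutesI: "(\<And>x. ev (map R n @ M) x = ev (M @ map R n) x) \<Longrightarrow> commutes n M"
  by (simp_all add: absorbs_left_def absorbs_right_def commutes_def)

text \<open>The moved root element times M is n e_k n M. The inner n is either swallowed by M or
  passes to its right end, which leaves e_k M with reflection words outside.\<close>

lemma nf_move:
  assumes "slides M n" "k < 24" "nf (eword k @ M)"
  shows "nf (eword (move n k) @ M)"
proof -
  have n: "set n \<subseteq> {1..4}" "rev n = n"
    using assms(1) by (simp_all add: slides_def)
  have e: "ev (eword (move n k)) = ev (map R n @ eword k @ map R n)"
    using eword_move[OF n(1) assms(2)] n(2) by simp
  consider "absorbs_left n M" | "commutes n M"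
    using assms(1) by (auto simp: slides_def)
  then show ?thesis
  proof cases
    case 1
    then have "ev (eword (move n k) @ M) = ev (map R n @ (eword k @ M) @ map R [])"
      using e by (simp add: fun_eq_iff absorbs_left_def)
    then show ?thesis
      using nf_conj[OF assms(3) n(1), of "[]"] by (simp cong: nf_cong)
  next
    case 2
    then have "ev (eword (move n k) @ M) = ev (map R n @ (eword k @ M) @ map R n)"
      using e by (simp add: fun_eq_iff commutes_def)
    then show ?thesis
      using nf_conj[OF assms(3) n(1) n(1)] by (simp cong: nf_cong)
  qed
qed

text \<open>A list of pairs \<open>(n, ks)\<close> certifies that an orbit is exhausted: each step adds the images under
  the word \<open>n\<close> of roots \<open>ks\<close> reached before. This is much cheaper to evaluate than a closure.\<close>

definition orbit_step :: "nat list \<times> nat list \<Rightarrow> nat list \<Rightarrow> nat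
  list" where
  "orbit_step = (\<lambda>(n, ks) rs. if set ks \<subseteq> set rs then map (move n) ks @ rs else
    rs)"

text \<open>A step that uses a root not yet reached leaves the list unchanged, so a faulty
  certificate could only spoil the later check that all 24 indices occur.\<close>

lemma nf_orbit:
  assumes "\<forall>k\<in>set rs. k < 24 \<and> nf (eword k @ M)" "\<forall>(n, ks)\<in>set ps.
    slides M n"
  shows "\<forall>k\<in>set (fold orbit_step ps rs). k < 24 \<and> nf (eword k @ M)"
  using assms
proof (induction ps arbitrary: rs)
  case (Cons p ps)
  obtain n ks where p: "p = (n, ks)"
    by fastforce
  have "\<forall>k\<in>set (orbit_step p rs). k < 24 \<and> nf (eword k @ M)"
  proof
    fix k
    assume "k \<in> set (orbit_step p rs)"
    then consider "k \<in> set rs" | k' where "k' \<in> set rs" "k = move n k'"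
      unfolding orbit_step_def p by (auto split: if_splits)
    then show "k < 24 \<and> nf (eword k @ M)"
      using Cons.prems move_less nf_move unfolding p by cases auto
  qed
  moreover have "\<forall>(n, ks)\<in>set ps. slides M n"
    using Cons.prems(2) unfolding list.set by blast
  ultimately show ?case
    unfolding fold_simps by (rule Cons.IH)
qed simp

text \<open>Here \<open>rs\<close> holds the roots whose products were computed, \<open>ps\<close>
  the orbit certificate. The covering hypothesis is closed and can be settled by evaluation.\<close>

lemma nf_E:
  assumes "\<forall>k\<in>set rs. k < 24 \<and> nf (eword k @ M)" "\<forall>(n, ks)\<in>set ps.
    slides M n"
    and "set [0..<24] \<subseteq> set (fold orbit_step ps rs)"
    and "j \<in> {1..4}" "set U \<subseteq> {1..4}"
  shows "nf (E j # map R U @ M)"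
proof -
  have all: "nf (eword k @ M)" if "k < 24" for k
  proof -
    have "k \<in> set [0..<24]" using that by simp
    then show ?thesis using assms(3) nf_orbit[OF assms(1,2)] by blast
  qed
  \<comment> \<open>Indices start at 0 and the simple roots come first in the table.\<close>
  have j: "eword (j - 1) = [E j]" "j - 1 < 24"
  proof -
    have "j \<in> {1, 2, 3, 4}" using assms(4) by auto
    then show "eword (j - 1) = [E j]" "j - 1 < 24"
      by (elim insertE emptyE; simp add: eword_def)+
  qed
  \<comment> \<open>Conjugating by the inverse of U gives the root element that remains once U has
    been moved to the left of \<open>E j\<close>.\<close>
  define k where "k = move (rev U) (j - 1)"
  have "ev (eword k) = ev (map R (rev U) @ [E j] @ map R U)"
    using eword_move[of "rev U" "j - 1"] assms(5) j by (simp add: k_def)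
  then have "ev (E j # map R U @ M) = ev (map R U @ (eword k @ M) @ map R [])"
    using R_cancel[of "rev U"] assms(5) by (simp add: fun_eq_iff)
  moreover have "nf (map R U @ (eword k @ M) @ map R [])"
    using nf_conj[OF all, of k U "[]"] move_less[OF j(2)] assms(5) by (simp add: k_def)
  ultimately show ?thesis
    by (simp cong: nf_cong)
qed

lemma shapeI:
  assumes "u \<in> DL" "v \<in> C" "w \<in> DR" "wimg u U" "wimg v V" "wimg (inv w) W"
  shows "shape DL M C DR (U @ M @ V @ W)"
  unfolding shape_def using assms by blast

section \<open>Reflections absorbed by, or commuting with, the middle words\<close>

lemma reflections_one:
  "commutes [1] []"
  "commutes [2] []"
  "commutes [3] []"
  "commutes [4] []"
  by (rule absorbs_leftI absorbs_rightI commutesI; simp)+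

lemma slides_one:
  "slides [] [1]"
  "slides [] [2]"
  "slides [] [3]"
  "slides [] [4]"
  using reflections_one by (simp_all add: slides_def)

text \<open>The words represent the reflections that generate N_1; the last one is the reflection in
  \<epsilon>_4 + \<epsilon>_3. Those that commute with the middle word generate C_1. The later
  tables follow the same pattern with the words of \<open>reflection_words\<close>.\<close>

lemma reflections_e4:
  "absorbs_left [4] [E 4]"
  "absorbs_right [4] [E 4]"
  "commutes [1] [E 4]"
  "commutes [2] [E 4]"
  "commutes [3, 4, 2, 3, 2, 4, 3] [E 4]"
  by (rule absorbs_leftI absorbs_rightI commutesI; simp)+

lemma slides_e4:
  "slides [E 4] [1]"
  "slides [E 4] [2]"
  "slides [E 4] [3, 4, 2, 3, 2, 4, 3]"
  "slides [E 4] [4]"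
  using reflections_e4 by (simp_all add: slides_def)

lemma reflections_e1:
  "absorbs_left [1] [E 1]"
  "absorbs_left [2, 3, 2, 1, 2, 3, 2] [E 1]"
  "absorbs_right [1] [E 1]"
  "absorbs_right [2, 3, 2, 1, 2, 3, 2] [E 1]"
  "commutes [3] [E 1]"
  "commutes [4] [E 1]"
  by (rule absorbs_leftI absorbs_rightI commutesI; simp)+

lemma slides_e1:
  "slides [E 1] [1]"
  "slides [E 1] [3]"
  "slides [E 1] [4]"
  "slides [E 1] [2, 3, 2, 1, 2, 3, 2]"
  using reflections_e1 by (simp_all add: slides_def)

lemma reflections_e3r2e3:
  "absorbs_left [2] [E 3, R 2, E 3]"
  "absorbs_left [3] [E 3, R 2, E 3]"
  "absorbs_left [4, 3, 2, 3, 4] [E 3, R 2, E 3]"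
  "absorbs_right [2] [E 3, R 2, E 3]"
  "absorbs_right [3] [E 3, R 2, E 3]"
  "absorbs_right [4, 3, 2, 3, 4] [E 3, R 2, E 3]"
  "commutes [1, 2, 3, 2, 1] [E 3, R 2, E 3]"
  by (rule absorbs_leftI absorbs_rightI commutesI; simp)+

lemma slides_e3r2e3:
  "slides [E 3, R 2, E 3] [2]"
  "slides [E 3, R 2, E 3] [3]"
  "slides [E 3, R 2, E 3] [4, 3, 2, 3, 4]"
  "slides [E 3, R 2, E 3] [1, 2, 3, 2, 1]"
  using reflections_e3r2e3 by (simp_all add: slides_def)

lemma reflections_e1e3:
  "absorbs_left [3] [E 1, E 3]"
  "absorbs_left [1] [E 1, E 3]"
  "absorbs_left [2, 3, 2, 1, 2, 3, 2] [E 1, E 3]"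
  "absorbs_left [3, 4, 2, 3, 2, 1, 2, 3, 2, 4, 3] [E 1, E 3]"
  "absorbs_right [3] [E 1, E 3]"
  "absorbs_right [1] [E 1, E 3]"
  "absorbs_right [2, 3, 2, 1, 2, 3, 2] [E 1, E 3]"
  "absorbs_right [3, 4, 2, 3, 2, 1, 2, 3, 2, 4, 3] [E 1, E 3]"
  by (rule absorbs_leftI absorbs_rightI commutesI; simp)+

lemma slides_e1e3:
  "slides [E 1, E 3] [3]"
  "slides [E 1, E 3] [1]"
  "slides [E 1, E 3] [2, 3, 2, 1, 2, 3, 2]"
  "slides [E 1, E 3] [3, 4, 2, 3, 2, 1, 2, 3, 2, 4, 3]"
  using reflections_e1e3 by (simp_all add: slides_def)

lemma reflections_e3r2r1e3r2e3:
  "absorbs_left [1] [E 3, R 2, R 1, E 3, R 2, E 3]"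
  "absorbs_left [2] [E 3, R 2, R 1, E 3, R 2, E 3]"
  "absorbs_left [3] [E 3, R 2, R 1, E 3, R 2, E 3]"
  "absorbs_left [4, 3, 2, 3, 4] [E 3, R 2, R 1, E 3, R 2, E 3]"
  "absorbs_left [1, 2, 3, 4, 2, 3, 2, 1, 2, 3, 2, 4, 3, 2, 1] [E 3, R 2, R 1, E 3, R 2, E 3]"
  "absorbs_right [1] [E 3, R 2, R 1, E 3, R 2, E 3]"
  "absorbs_right [2] [E 3, R 2, R 1, E 3, R 2, E 3]"
  "absorbs_right [3] [E 3, R 2, R 1, E 3, R 2, E 3]"
  "absorbs_right [4, 3, 2, 3, 4] [E 3, R 2, R 1, E 3, R 2, E 3]"
  "absorbs_right [1, 2, 3, 4, 2, 3, 2, 1, 2, 3, 2, 4, 3, 2, 1] [E 3, R 2, R 1, E 3, R 2, E 3]"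
  by (rule absorbs_leftI absorbs_rightI commutesI; simp)+

lemma slides_e3r2r1e3r2e3:
  "slides [E 3, R 2, R 1, E 3, R 2, E 3] [1]"
  "slides [E 3, R 2, R 1, E 3, R 2, E 3] [2]"
  "slides [E 3, R 2, R 1, E 3, R 2, E 3] [3]"
  "slides [E 3, R 2, R 1, E 3, R 2, E 3] [4, 3, 2, 3, 4]"
  "slides [E 3, R 2, R 1, E 3, R 2, E 3] [1, 2, 3, 4, 2, 3, 2, 1, 2, 3, 2, 4, 3, 2, 1]"
  using reflections_e3r2r1e3r2e3 by (simp_all add: slides_def)

text \<open>The two sides differ: the left absorbs \<open>[3]\<close>, the reflection in \<beta>_3,
  the right \<open>[3, 2, 3]\<close>, the reflection in \<epsilon>_3. This is the difference between
  \<open>N6L\<close> and \<open>N6R\<close>.\<close>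

lemma reflections_e3e2:
  "absorbs_left [2] [E 3, E 2]"
  "absorbs_left [3] [E 3, E 2]"
  "absorbs_left [4, 3, 2, 3, 4] [E 3, E 2]"
  "absorbs_right [2] [E 3, E 2]"
  "absorbs_right [3, 2, 3] [E 3, E 2]"
  "absorbs_right [4, 3, 2, 3, 4] [E 3, E 2]"
  "commutes [1, 2, 3, 2, 1] [E 3, E 2]"
  by (rule absorbs_leftI absorbs_rightI commutesI; simp)+

lemma slides_e3e2:
  "slides [E 3, E 2] [2]"
  "slides [E 3, E 2] [3]"
  "slides [E 3, E 2] [4, 3, 2, 3, 4]"
  "slides [E 3, E 2] [1, 2, 3, 2, 1]"
  using reflections_e3e2 by (simp_all add: slides_def)

lemma reflections_e2e3:
  "absorbs_left [2] [E 2, E 3]"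
  "absorbs_left [3, 2, 3] [E 2, E 3]"
  "absorbs_left [4, 3, 2, 3, 4] [E 2, E 3]"
  "absorbs_right [2] [E 2, E 3]"
  "absorbs_right [3] [E 2, E 3]"
  "absorbs_right [4, 3, 2, 3, 4] [E 2, E 3]"
  "commutes [1, 2, 3, 2, 1] [E 2, E 3]"
  by (rule absorbs_leftI absorbs_rightI commutesI; simp)+

lemma slides_e2e3:
  "slides [E 2, E 3] [2]"
  "slides [E 2, E 3] [3, 2, 3]"
  "slides [E 2, E 3] [4, 3, 2, 3, 4]"
  "slides [E 2, E 3] [1, 2, 3, 2, 1]"
  using reflections_e2e3 by (simp_all add: slides_def)

lemma reflections_e4r3e2e3e4:
  "absorbs_left [2] [E 4, R 3, E 2, E 3, E 4]"
  "absorbs_left [4] [E 4, R 3, E 2, E 3, E 4]"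
  "absorbs_left [1, 2, 3, 4, 2, 3, 2, 1, 2, 3, 2, 4, 3, 2, 1] [E 4, R 3, E 2, E 3, E 4]"
  "absorbs_left [3, 2, 3] [E 4, R 3, E 2, E 3, E 4]"
  "absorbs_right [2] [E 4, R 3, E 2, E 3, E 4]"
  "absorbs_right [4] [E 4, R 3, E 2, E 3, E 4]"
  "absorbs_right [1, 2, 3, 4, 2, 3, 2, 1, 2, 3, 2, 4, 3, 2, 1] [E 4, R 3, E 2, E 3, E 4]"
  "absorbs_right [3, 2, 3] [E 4, R 3, E 2, E 3, E 4]"
  by (rule absorbs_leftI absorbs_rightI commutesI; simp)+

lemma slides_e4r3e2e3e4:
  "slides [E 4, R 3, E 2, E 3, E 4] [2]"
  "slides [E 4, R 3, E 2, E 3, E 4] [4]"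
  "slides [E 4, R 3, E 2, E 3, E 4] [1, 2, 3, 4, 2, 3, 2, 1, 2, 3, 2, 4, 3, 2, 1]"
  "slides [E 4, R 3, E 2, E 3, E 4] [3, 2, 3]"
  using reflections_e4r3e2e3e4 by (simp_all add: slides_def)

text \<open>The left side absorbs the generators of N_5, the right side those of N_4, and nothing
  has to commute. This is why form (V) has no middle factor.\<close>

lemma reflections_e3e2e1e3:
  "absorbs_left [1] [E 3, E 2, E 1, E 3]"
  "absorbs_left [2] [E 3, E 2, E 1, E 3]"
  "absorbs_left [3] [E 3, E 2, E 1, E 3]"
  "absorbs_left [4, 3, 2, 3, 4] [E 3, E 2, E 1, E 3]"
  "absorbs_left [1, 2, 3, 4, 2, 3, 2, 1, 2, 3, 2, 4, 3, 2, 1] [E 3, E 2, E 1, E 3]"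
  "absorbs_right [3] [E 3, E 2, E 1, E 3]"
  "absorbs_right [1] [E 3, E 2, E 1, E 3]"
  "absorbs_right [2, 3, 2, 1, 2, 3, 2] [E 3, E 2, E 1, E 3]"
  "absorbs_right [3, 4, 2, 3, 2, 1, 2, 3, 2, 4, 3] [E 3, E 2, E 1, E 3]"
  by (rule absorbs_leftI absorbs_rightI commutesI; simp)+

lemma slides_e3e2e1e3:
  "slides [E 3, E 2, E 1, E 3] [1]"
  "slides [E 3, E 2, E 1, E 3] [2]"
  "slides [E 3, E 2, E 1, E 3] [3]"
  "slides [E 3, E 2, E 1, E 3] [4, 3, 2, 3, 4]"
  "slides [E 3, E 2, E 1, E 3] [1, 2, 3, 4, 2, 3, 2, 1, 2, 3, 2, 4, 3, 2, 1]"
  using reflections_e3e2e1e3 by (simp_all add: slides_def)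

lemma reflections_e3e1e2e3:
  "absorbs_left [3] [E 3, E 1, E 2, E 3]"
  "absorbs_left [1] [E 3, E 1, E 2, E 3]"
  "absorbs_left [2, 3, 2, 1, 2, 3, 2] [E 3, E 1, E 2, E 3]"
  "absorbs_left [3, 4, 2, 3, 2, 1, 2, 3, 2, 4, 3] [E 3, E 1, E 2, E 3]"
  "absorbs_right [1] [E 3, E 1, E 2, E 3]"
  "absorbs_right [2] [E 3, E 1, E 2, E 3]"
  "absorbs_right [3] [E 3, E 1, E 2, E 3]"
  "absorbs_right [4, 3, 2, 3, 4] [E 3, E 1, E 2, E 3]"
  "absorbs_right [1, 2, 3, 4, 2, 3, 2, 1, 2, 3, 2, 4, 3, 2, 1] [E 3, E 1, E 2, E 3]"
  by (rule absorbs_leftI absorbs_rightI commutesI; simp)+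

lemma slides_e3e1e2e3:
  "slides [E 3, E 1, E 2, E 3] [3]"
  "slides [E 3, E 1, E 2, E 3] [1]"
  "slides [E 3, E 1, E 2, E 3] [2, 3, 2, 1, 2, 3, 2]"
  "slides [E 3, E 1, E 2, E 3] [3, 4, 2, 3, 2, 1, 2, 3, 2, 4, 3]"
  using reflections_e3e1e2e3 by (simp_all add: slides_def)

section \<open>Orbit certificates for the eleven middle words\<close>

lemma nf_E_one:
  assumes "j \<in> {1..4}" "set U \<subseteq> {1..4}"
  shows "nf (E j # map R U @ [])"
proof (rule nf_E[OF _ _ _ assms])
  show "\<forall>k\<in>set [0, 3]. k < 24 \<and> nf (eword k @ [])"
    using products_one[THEN nf_reducible] by simp
  \<comment> \<open>Only the words \<open>n\<close> matter for this obligation; the index lists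
    \<open>ks\<close> are what drives the evaluation.\<close>
  show "\<forall>(n, ks :: nat list)\<in>set
      [([2], [0]), ([1], [4]), ([3], [1, 4, 3]), ([2], [8, 7]), ([1], [11]), ([3], [14, 11]),
       ([2], [17]), ([3], [19]), ([4], [21, 14, 12, 11, 5, 8, 7]), ([3], [16]), ([2], [18]),
       ([1], [20])]. slides [] n"
    using slides_one by simp
\<comment> \<open>What remains is the covering condition: the steps reach all 24 roots.\<close>
qed code_simp

lemma nf_E_e4:
  assumes "j \<in> {1..4}" "set U \<subseteq> {1..4}"
  shows "nf (E j # map R U @ [E 4])"
proof (rule nf_E[OF _ _ _ assms])
  show "\<forall>k\<in>set [0, 2, 3, 5, 15]. k < 24 \<and> nf (eword k @ [E 4])"
    using products_e4[THEN nf_reducible] by simp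
  show "\<forall>(n, ks :: nat list)\<in>set
      [([1], [5, 15]), ([2], [8, 17, 0, 2]), ([1], [4, 6]), ([4], [10, 12, 6, 8, 2, 5]),
       ([3, 4, 2, 3, 2, 4, 3], [14, 10, 4, 0]), ([1], [20])]. slides [E 4] n"
    using slides_e4 by simp
qed code_simp

lemma nf_E_e1:
  assumes "j \<in> {1..4}" "set U \<subseteq> {1..4}"
  shows "nf (E j # map R U @ [E 1])"
proof (rule nf_E[OF _ _ _ assms])
  show "\<forall>k\<in>set [0, 1, 2, 6, 12]. k < 24 \<and> nf (eword k @ [E 1])"
    using products_e1[THEN nf_reducible] by simp
  show "\<forall>(n, ks :: nat list)\<in>set
      [([1], [1, 6]), ([3], [4, 1]), ([4], [8, 5, 10, 2, 6, 12]), ([3], [14, 7, 11, 16]),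
       ([2, 3, 2, 1, 2, 3, 2], [3, 13, 9, 7]), ([4], [21])]. slides [E 1] n"
    using slides_e1 by simp
qed code_simp

lemma nf_E_e3r2e3:
  assumes "j \<in> {1..4}" "set U \<subseteq> {1..4}"
  shows "nf (E j # map R U @ [E 3, R 2, E 3])"
proof (rule nf_E[OF _ _ _ assms])
  show "\<forall>k\<in>set [0, 1, 2, 3, 9, 10]. k < 24 \<and> nf (eword k @ [E 3, R 2, E 3])"
    using products_e3r2e3[THEN nf_reducible] by simp
  show "\<forall>(n, ks :: nat list)\<in>set
      [([2], [0, 2]), ([3], [4, 1, 3]), ([2], [8, 7]), ([3], [11]),
       ([4, 3, 2, 3, 4], [12, 8, 4, 0, 10]), ([1, 2, 3, 2, 1], [15, 11, 7, 3, 9])]. slides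
         [E 3, R 2, E 3] n"
    using slides_e3r2e3 by simp
qed code_simp

lemma nf_E_e1e3:
  assumes "j \<in> {1..4}" "set U \<subseteq> {1..4}"
  shows "nf (E j # map R U @ [E 1, E 3])"
proof (rule nf_E[OF _ _ _ assms])
  show "\<forall>k\<in>set [0, 1, 2, 3, 6, 11, 12, 16]. k < 24 \<and> nf (eword k @ [E 1, E 3])"
    using products_e1e3[THEN nf_reducible] by simp
  show "\<forall>(n, ks :: nat list)\<in>set
      [([3], [1, 3, 11, 16]), ([1], [5, 15, 1, 6, 11]), ([2, 3, 2, 1, 2, 3, 2], [7, 3]),
       ([3, 4, 2, 3, 2, 1, 2, 3, 2, 4, 3], [8, 4, 5, 1, 2])]. slides [E 1, E 3] n"
    using slides_e1e3 by simp
qed code_simp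

lemma nf_E_e3r2r1e3r2e3:
  assumes "j \<in> {1..4}" "set U \<subseteq> {1..4}"
  shows "nf (E j # map R U @ [E 3, R 2, R 1, E 3, R 2, E 3])"
proof (rule nf_E[OF _ _ _ assms])
  show "\<forall>k\<in>set [0, 2, 3]. k < 24 \<and> nf (eword k @ [E 3, R 2, R 1, E 3, R 2, E 3])"
    using products_e3r2r1e3r2e3[THEN nf_reducible] by simp
  show "\<forall>(n, ks :: nat list)\<in>set
      [([2], [0, 2]), ([1], [4, 6]), ([3], [1, 4, 3]), ([2], [8, 7]), ([1], [11]),
       ([3], [14, 11]), ([2], [17]), ([3], [19]), ([4, 3, 2, 3, 4], [12, 8, 10, 4, 0]),
       ([1], [20, 13])]. slides [E 3, R 2, R 1, E 3, R 2, E 3] n"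
    using slides_e3r2r1e3r2e3 by simp
qed code_simp

lemma nf_E_e3e2:
  assumes "j \<in> {1..4}" "set U \<subseteq> {1..4}"
  shows "nf (E j # map R U @ [E 3, E 2])"
proof (rule nf_E[OF _ _ _ assms])
  show "\<forall>k\<in>set [0, 1, 2, 3, 9, 10]. k < 24 \<and> nf (eword k @ [E 3, E 2])"
    using products_e3e2[THEN nf_reducible] by simp
  show "\<forall>(n, ks :: nat list)\<in>set
      [([2], [0, 2]), ([3], [4, 1, 3]), ([2], [8, 7]), ([3], [11]),
       ([4, 3, 2, 3, 4], [12, 8, 4, 0, 10]), ([1, 2, 3, 2, 1], [15, 11, 7, 3, 9])]. slides
         [E 3, E 2] n"
    using slides_e3e2 by simp
qed code_simp

lemma nf_E_e2e3:
  assumes "j \<in> {1..4}" "set U \<subseteq> {1..4}"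
  shows "nf (E j # map R U @ [E 2, E 3])"
proof (rule nf_E[OF _ _ _ assms])
  show "\<forall>k\<in>set [0, 1, 2, 3, 5, 7, 9, 10]. k < 24 \<and> nf (eword k @ [E 2, E 3])"
    using products_e2e3[THEN nf_reducible] by simp
  show "\<forall>(n, ks :: nat list)\<in>set
      [([2], [0, 2, 7]), ([3, 2, 3], [4, 0, 3]), ([4, 3, 2, 3, 4], [12, 8, 4, 0, 10]),
       ([1, 2, 3, 2, 1], [15, 11, 3, 7, 9])]. slides [E 2, E 3] n"
    using slides_e2e3 by simp
qed code_simp

lemma nf_E_e4r3e2e3e4:
  assumes "j \<in> {1..4}" "set U \<subseteq> {1..4}"
  shows "nf (E j # map R U @ [E 4, R 3, E 2, E 3, E 4])"
proof (rule nf_E[OF _ _ _ assms])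
  show "\<forall>k\<in>set [0, 1, 2, 3, 5, 10, 17, 22]. k < 24 \<and> nf (eword k @
    [E 4, R 3, E 2, E 3, E 4])"
    using products_e4r3e2e3e4[THEN nf_reducible] by simp
  show "\<forall>(n, ks :: nat list)\<in>set
      [([2], [0, 2, 17]), ([4], [6, 2, 5, 10]), ([3, 2, 3], [14, 4, 0, 3]), ([4], [21, 12, 8]),
       ([3, 2, 3], [16, 13])]. slides [E 4, R 3, E 2, E 3, E 4] n"
    using slides_e4r3e2e3e4 by simp
qed code_simp

lemma nf_E_e3e2e1e3:
  assumes "j \<in> {1..4}" "set U \<subseteq> {1..4}"
  shows "nf (E j # map R U @ [E 3, E 2, E 1, E 3])"
proof (rule nf_E[OF _ _ _ assms])
  show "\<forall>k\<in>set [0, 2, 3]. k < 24 \<and> nf (eword k @ [E 3, E 2, E 1, E 3])"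
    using products_e3e2e1e3[THEN nf_reducible] by simp
  show "\<forall>(n, ks :: nat list)\<in>set
      [([2], [0, 2]), ([1], [4, 6]), ([3], [1, 4, 3]), ([2], [8, 7]), ([1], [11]),
       ([3], [14, 11]), ([2], [17]), ([3], [19]), ([4, 3, 2, 3, 4], [12, 8, 10, 4, 0]),
       ([1], [20, 13])]. slides [E 3, E 2, E 1, E 3] n"
    using slides_e3e2e1e3 by simp
qed code_simp

lemma nf_E_e3e1e2e3:
  assumes "j \<in> {1..4}" "set U \<subseteq> {1..4}"
  shows "nf (E j # map R U @ [E 3, E 1, E 2, E 3])"
proof (rule nf_E[OF _ _ _ assms])
  show "\<forall>k\<in>set [0, 1, 2, 3, 6, 11, 12, 16]. k < 24 \<and> nf (eword k @
    [E 3, E 1, E 2, E 3])"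
    using products_e3e1e2e3[THEN nf_reducible] by simp
  show "\<forall>(n, ks :: nat list)\<in>set
      [([3], [1, 3, 11, 16]), ([1], [5, 15, 1, 6, 11]), ([2, 3, 2, 1, 2, 3, 2], [7, 3]),
       ([3, 4, 2, 3, 2, 1, 2, 3, 2, 4, 3], [8, 4, 5, 1, 2])]. slides [E 3, E 1, E 2, E 3] n"
    using slides_e3e1e2e3 by simp
qed code_simp

lemma nf_E_mids: "M \<in> mids \<Longrightarrow> j \<in> {1..4} \<Longrightarrow> set U
  \<subseteq> {1..4} \<Longrightarrow> nf (E j # map R U @ M)"
  unfolding mids_def
  by (elim insertE emptyE; hypsubst)
    (rule nf_E_one nf_E_e4 nf_E_e1 nf_E_e3r2e3 nf_E_e1e3 nf_E_e3r2r1e3r2e3 nf_E_e3e2 nf_E_e2e3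
      nf_E_e4r3e2e3e4 nf_E_e3e2e1e3 nf_E_e3e1e2e3; assumption)+

lemma nf_Cons_E:
  assumes "nf a" "j \<in> {1..4}"
  shows "nf (E j # a)"
proof -
  obtain k U M V where M: "M \<in> mids" "set U \<subseteq> {1..4}" "set V \<subseteq> {1..4}"
    "ev a = ev (dpow k @ map R U @ M @ map R V)"
    using assms(1) unfolding nf_def by blast
  obtain k' U' M' V' where M': "M' \<in> mids" "set U' \<subseteq> {1..4}" "set V' \<subseteq>
    {1..4}"
    "ev (E j # map R U @ M) = ev (dpow k' @ map R U' @ M' @ map R V')"
    using nf_E_mids[OF M(1) assms(2) M(2)] unfolding nf_def by blast
  have "ev (E j # a) x = ev (dpow (k + k') @ map R U' @ M' @ map R (V' @ V)) x" for x
  proof -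
    have "ev (E j # a) x = ev (dpow k) (ev (E j # map R U @ M) (ev (map R V) x))"
      using M(4) by (simp add: act_dpow)
    also have "\<dots> = ev (dpow k) (ev (dpow k') (ev (map R U' @ M' @ map R (V' @ V)) x))"
      using M'(4) by simp
    finally show ?thesis
      by (simp add: dpow_add)
  qed
  moreover have "set (V' @ V) \<subseteq> {1..4}"
    using M(3) M'(3) by simp
  ultimately show ?thesis
    unfolding nf_def using M'(1,2) by blast
qed

lemma nf_all: "list_all valid_letter a \<Longrightarrow> nf a"
proof (induction a)
  case Nil
  have "ev [] = ev (dpow 0 @ map R [] @ [] @ map R [])" "[] \<in> mids"
    by (simp_all add: mids_def)
  then show ?case
    unfolding nf_def by (metis empty_subsetI list.set(1))
next
  case (Cons l a)
  then have "nf a" by simp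
  show ?case
  proof (cases l)
    case (R i)
    then show ?thesis
      using nf_conj[OF \<open>nf a\<close>, of "[i]" "[]"] Cons.prems by (simp add:
        valid_letter_def)
  next
    case (E j)
    then show ?thesis
      using nf_Cons_E[OF \<open>nf a\<close>] Cons.prems by (simp add: valid_letter_def)
  qed (simp_all add: nf_Dl nf_Di \<open>nf a\<close>)
qed

section \<open>Words for reflections and root elements\<close>

lemma vector_4: "(vector [w, x, y, z] :: 'a::zero ^ 4) $ 1 = w" "(vector [w, x, y, z] :: 'a ^ 4)
  $ 2 = x"
    "(vector [w, x, y, z] :: 'a ^ 4) $ 3 = y" "(vector [w, x, y, z] :: 'a ^ 4) $ 4 = z"
  by (simp_all add: vector_def)

lemma inner_v4: "v4 a b c d \<bullet> v4 w x y z = a * w + b * x + c * y + d * z"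
  by (simp add: inner_vec_def v4_def sum_4 vector_4)

lemma diff_scaleR_v4: "v4 a b c d - q *\<^sub>R v4 w x y z = v4 (a - q * w) (b - q * x) (c - q *
  y) (d - q * z)"
  by (simp add: vec_eq_iff forall_4 v4_def vector_4)

lemma uminus_v4: "- v4 a b c d = v4 (- a) (- b) (- c) (- d)"
  by (simp add: vec_eq_iff forall_4 v4_def vector_4)

lemma v4_eq_iff: "v4 a b c d = v4 w x y z \<longleftrightarrow> a = w \<and> b = x \<and> c = y
  \<and> d = z"
  by (simp add: vec_eq_iff forall_4 v4_def vector_4)

text \<open>The entries are written as the simplifier normalises them, \<open>- (1/2)\<close> for
  \<open>-1/2\<close>, so that the rules match the unfolded \<open>beta\<close>.\<close>

lemma refl_v4:
  "refl (v4 (1/2) (- (1/2)) (- (1/2)) (- (1/2))) (v4 a b c d) =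
    v4 ((a + b + c + d) / 2) ((a + b - c - d) / 2) ((a - b + c - d) / 2) ((a - b - c + d) / 2)"
  "refl (v4 0 1 0 0) (v4 a b c d) = v4 a (- b) c d"
  "refl (v4 0 (- 1) 1 0) (v4 a b c d) = v4 a c b d"
  "refl (v4 0 0 (- 1) 1) (v4 a b c d) = v4 a b d c"
  by (simp_all add: refl_def inner_v4 diff_scaleR_v4 v4_eq_iff field_simps)

lemma linear_refl: "linear (refl \<alpha>)"
  by (rule linearI) (simp_all add: refl_def inner_add_left algebra_simps add_divide_distrib)

lemma refl_refl [simp]: "refl \<alpha> (refl \<alpha> x) = x"
  by (cases "\<alpha> = 0") (simp_all add: refl_def inner_diff_left)

lemma inner_refl: "refl \<alpha> x \<bullet> y = x \<bullet> refl \<alpha> y"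
  by (simp add: refl_def inner_diff_left inner_diff_right inner_commute)

text \<open>A reflection is a linear, self-adjoint involution. It can therefore be moved across the
  inner product with \<beta>, and it preserves the norm of \<beta> in the denominator.\<close>

lemma refl_conj: "refl (refl \<alpha> \<beta>) = refl \<alpha> \<circ> refl \<beta> \<circ> refl
  \<alpha>"
proof
  fix x
  have "refl \<alpha> (refl \<alpha> x - c *\<^sub>R \<beta>) = x - c *\<^sub>R refl \<alpha>
    \<beta>" for c
    by (simp add: linear_diff[OF linear_refl] linear_scale[OF linear_refl])
  then show "refl (refl \<alpha> \<beta>) x = (refl \<alpha> \<circ> refl \<beta> \<circ> refl
    \<alpha>) x"
    unfolding refl_def[of "refl \<alpha> \<beta>"] refl_def[of \<beta>] by (simp add: inner_refl)
qed

lemma rprod_Cons: "rprod (\<alpha> # as) = refl \<alpha> \<circ> rprod as"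
  by (simp add: rprod_def)

lemma rprod_Nil [simp]: "rprod [] = id"
  by (simp add: rprod_def)

lemma rprod_append: "rprod (as @ bs) = rprod as \<circ> rprod bs"
  by (induction as) (simp_all add: rprod_Cons o_assoc)

lemma rprod_rev_cancel: "rprod (rev as) \<circ> rprod as = id"
proof (induction as)
  case (Cons \<alpha> as)
  have "rprod (rev (\<alpha> # as)) \<circ> rprod (\<alpha> # as) = rprod (rev as) \<circ> (refl
    \<alpha> \<circ> refl \<alpha>) \<circ> rprod as"
    by (simp add: rprod_append rprod_Cons o_assoc)
  also have "refl \<alpha> \<circ> refl \<alpha> = id" by (simp add: fun_eq_iff)
  finally show ?case using Cons by simp
qed simp

lemma rprod_rev: "rprod (rev as) = inv (rprod as)"
  using rprod_rev_cancel[of as] rprod_rev_cancel[of "rev as"] by (simp add: inv_unique_comp)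

lemma gen_Cons: "\<gamma> \<in> set gs \<Longrightarrow> w \<in> gen gs \<Longrightarrow> refl
  \<gamma> \<circ> w \<in> gen gs"
proof -
  assume "\<gamma> \<in> set gs" "w \<in> gen gs"
  then obtain as where "refl \<gamma> \<circ> w = rprod (\<gamma> # as)" "set (\<gamma> # as)
    \<subseteq> set gs"
    unfolding gen_def by (auto simp: rprod_Cons)
  then show ?thesis
    unfolding gen_def by blast
qed

lemma gen_Nil: "gen [] = {id}"
  by (auto simp: gen_def)

lemma id_in_gen: "id \<in> gen gs"
  unfolding gen_def by (auto intro!: exI[of _ "[]"])

lemma rprod_in_WF4: "set U \<subseteq> {1..4} \<Longrightarrow> rprod (map beta U) \<in> WF4"
proof -
  assume "set U \<subseteq> {1..4}"
  then have "set U \<subseteq> {1, 2, 3, 4}" by force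
  then show ?thesis
    unfolding WF4_def gen_def by (intro CollectI exI[of _ "map beta U"]) auto
qed

lemma WF4_wword:
  assumes "w \<in> WF4"
  shows "\<exists>U. wword w U"
proof -
  obtain as where as: "w = rprod as" "set as \<subseteq> beta ` {1, 2, 3, 4}"
    using assms unfolding WF4_def gen_def by auto
  then have "as \<in> lists (beta ` {1, 2, 3, 4})"
    by auto
  then obtain U where "as = map beta U" "set U \<subseteq> {1, 2, 3, 4}"
    unfolding lists_image by auto
  with as(1) show ?thesis
    by (intro exI[of _ U]) (auto simp: wword_def)
qed

lemma wword_append: "wword v U \<Longrightarrow> wword w V \<Longrightarrow> wword (v \<circ> w)
  (U @ V)"
  by (auto simp: wword_def rprod_append)

lemma wword_rev: "wword w U \<Longrightarrow> wword (inv w) (rev U)"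
  by (auto simp: wword_def rprod_rev simp flip: rev_map)

lemma wword_inv_cancel: "wword w U \<Longrightarrow> inv w \<circ> w = id" "wword w U
  \<Longrightarrow> w \<circ> inv w = id"
  using rprod_rev_cancel[of "map beta U"] rprod_rev_cancel[of "rev (map beta U)"]
  by (auto simp: wword_def simp flip: rprod_rev)

lemma wword_Nil: "wword id []"
  by (simp add: wword_def)

lemma wword_beta: "i \<in> {1..4} \<Longrightarrow> wword (refl (beta i)) [i]"
  by (simp add: wword_def rprod_Cons)

lemma wword_conj: "wword (refl \<gamma>) n \<Longrightarrow> i \<in> {1..4} \<Longrightarrow>
  wword (refl (refl (beta i) \<gamma>)) (i # n @ [i])"
  by (auto simp: wword_def refl_conj rprod_Cons rprod_append o_assoc)

lemma refl_uminus: "refl (- \<gamma>) = refl \<gamma>"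
  by (simp add: refl_def fun_eq_iff)

lemma erootI:
  assumes "set U \<subseteq> {1..4}" "j \<in> {1..4}"
    and "rprod (map beta U) (beta j) = b \<or> rprod (map beta U) (beta j) = - b"
  shows "eroot b (map R U @ [E j] @ map R (rev U))"
proof -
  have "wword (rprod (map beta U)) U"
    using assms by (simp add: wword_def)
  then show ?thesis
    unfolding eroot_def wimg_def using assms rprod_in_WF4 wword_rev by blast
qed

lemma reflection_words:
  "wword (refl (v4 0 0 1 1)) [3, 4, 2, 3, 2, 4, 3]"
  "wword (refl (v4 (1/2) (1/2) (1/2) (-1/2))) [2, 3, 2, 1, 2, 3, 2]"
  "wword (refl (v4 0 0 0 1)) [4, 3, 2, 3, 4]"
  "wword (refl (v4 0 0 1 0)) [3, 2, 3]"
  "wword (refl (v4 (-1) 0 0 1)) [1, 2, 3, 2, 1]"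
  "wword (refl (v4 (1/2) (-1/2) (1/2) (1/2))) [3, 4, 2, 3, 2, 1, 2, 3, 2, 4, 3]"
  "wword (refl (v4 1 0 0 0)) [1, 2, 3, 4, 2, 3, 2, 1, 2, 3, 2, 4, 3, 2, 1]"
proof -
  \<comment> \<open>Each listed root is the image of a simple root under a word U, up to sign, so
    its reflection has the palindrome \<open>U @ [j] @ rev U\<close> as a word.\<close>
  have w: "set U \<subseteq> {1..4} \<Longrightarrow> j \<in> {1..4} \<Longrightarrow>
      wword (refl (rprod (map beta U) (beta j))) (U @ [j] @ rev U)" for U j
  proof (induction U)
    case Nil
    then show ?case using wword_beta by simp
  next
    case (Cons i U)
    then show ?case
      using wword_conj[of "rprod (map beta U) (beta j)" "U @ [j] @ rev U" i] by (simp add: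
        rprod_Cons)
  qed
  show "wword (refl (v4 0 0 1 1)) [3, 4, 2, 3, 2, 4, 3]"
    using w[of "[3, 4, 2]" 3] by (simp add: rprod_Cons refl_v4 beta_def del: One_nat_def)
  show "wword (refl (v4 (1/2) (1/2) (1/2) (-1/2))) [2, 3, 2, 1, 2, 3, 2]"
    using w[of "[2, 3, 2]" 1] by (simp add: rprod_Cons refl_v4 beta_def del: One_nat_def)
  show "wword (refl (v4 0 0 0 1)) [4, 3, 2, 3, 4]"
    using w[of "[4, 3]" 2] by (simp add: rprod_Cons refl_v4 beta_def del: One_nat_def)
  show "wword (refl (v4 0 0 1 0)) [3, 2, 3]"
    using w[of "[3]" 2] by (simp add: rprod_Cons refl_v4 beta_def del: One_nat_def)
  \<comment> \<open>The word \<open>[1, 2]\<close> carries \<beta>_3 to \<epsilon>_1 - \<epsilon>_4,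
    the negative of the root wanted.\<close>
  show "wword (refl (v4 (-1) 0 0 1)) [1, 2, 3, 2, 1]"
    using w[of "[1, 2]" 3] refl_uminus[of "v4 1 0 0 (-1)"]
    by (simp add: rprod_Cons refl_v4 beta_def uminus_v4 del: One_nat_def)
  show "wword (refl (v4 (1/2) (-1/2) (1/2) (1/2))) [3, 4, 2, 3, 2, 1, 2, 3, 2, 4, 3]"
    using w[of "[3, 4, 2, 3, 2]" 1] by (simp add: rprod_Cons refl_v4 beta_def del: One_nat_def)
  show "wword (refl (v4 1 0 0 0)) [1, 2, 3, 4, 2, 3, 2, 1, 2, 3, 2, 4, 3, 2, 1]"
    using w[of "[1, 2, 3, 4, 2, 3, 2]" 1] by (simp add: rprod_Cons refl_v4 beta_def del:
      One_nat_def)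
qed

lemma reflection_beta:
  "wword (refl (beta 1)) [1]" "wword (refl (beta 2)) [2]" "wword (refl (beta 3)) [3]" "wword
    (refl (beta 4)) [4]"
  by (intro wword_beta; simp)+

section \<open>Words for the elements e_X\<close>

lemma eX_0: "eX (Xs 0) []"
  unfolding eX_def Xs_def by (intro exI[of _ "[]"]) simp

lemma eX_1: "eX (Xs 1) [E 4]"
  using erootI[of "[]" 4 "beta 4"] unfolding eX_def Xs_def by (intro exI[of _ "[[E 4]]"]) simp

lemma eX_2: "eX (Xs 2) [E 1]"
  using erootI[of "[]" 1 "beta 1"] unfolding eX_def Xs_def by (intro exI[of _ "[[E 1]]"]) simp

lemma
  shows eX_3: "eX (Xs 3) [E 3, R 2, E 3, R 2]"
    and eX_4: "eX (Xs 4) ([E 1, E 3] @ map R [3, 4, 2, 3, 2, 1, 2, 3, 2, 4, 3] @ [E 3] @ map R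
      [3, 4, 2, 3, 2, 1, 2, 3, 2, 4, 3])"
    and eX_5: "eX (Xs 5) ([E 3, R 2, E 3, R 2] @ map R [3, 4, 2, 3, 1, 2, 3, 4, 1, 2, 1] @ [E 3] @
      map R [1, 2, 1, 4, 3, 2, 1, 3, 2, 4, 3] @ [R 1, R 2, E 3, R 2, R 1])"
proof -
  have 1: "eroot (beta 1) [E 1]" "eroot (beta 3) [E 3]" "eroot (v4 0 (-1) 1 0) [E 3]"
    "eroot (v4 0 1 1 0) [R 2, E 3, R 2]" "eroot (v4 (-1) 0 0 1) [R 1, R 2, E 3, R 2, R 1]"
    using erootI[of "[]" 1] erootI[of "[]" 3] erootI[of "[2]" 3]
      erootI[of "[1, 2]" 3 "v4 (-1) 0 0 1"]
    by (simp_all add: rprod_Cons refl_v4 beta_def uminus_v4 del: One_nat_def)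
  have 2: "eroot (v4 1 0 0 1) (map R [3, 4, 2, 3, 2, 1, 2, 3, 2, 4, 3] @ [E 3] @ map R (rev
    [3, 4, 2, 3, 2, 1, 2, 3, 2, 4, 3]))"
    by (rule erootI) (simp_all add: rprod_Cons refl_v4 beta_def uminus_v4 v4_eq_iff del:
      One_nat_def)
  \<comment> \<open>A second word for the root element of \<epsilon>_1 + \<epsilon>_4. Any word is
    admissible in \<open>eroot\<close>, and this one lets \<open>ev_X5\<close> be proved by
    rewriting alone.\<close>
  have 3: "eroot (v4 1 0 0 1) (map R [3, 4, 2, 3, 1, 2, 3, 4, 1, 2, 1] @ [E 3] @ map R (rev
    [3, 4, 2, 3, 1, 2, 3, 4, 1, 2, 1]))"
    by (rule erootI) (simp_all add: rprod_Cons refl_v4 beta_def uminus_v4 v4_eq_iff del: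
      One_nat_def)
  show "eX (Xs 3) [E 3, R 2, E 3, R 2]"
    unfolding eX_def Xs_def using 1 by (intro exI[of _ "[[E 3], [R 2, E 3, R 2]]"]) simp
  show "eX (Xs 4) ([E 1, E 3] @ map R [3, 4, 2, 3, 2, 1, 2, 3, 2, 4, 3] @ [E 3] @ map R
    [3, 4, 2, 3, 2, 1, 2, 3, 2, 4, 3])"
    unfolding eX_def Xs_def using 1 2
    by (intro exI[of _ "[[E 1], [E 3], map R [3, 4, 2, 3, 2, 1, 2, 3, 2, 4, 3] @ [E 3] @ map R
      (rev [3, 4, 2, 3, 2, 1, 2, 3, 2, 4, 3])]"]) simp
  show "eX (Xs 5) ([E 3, R 2, E 3, R 2] @ map R [3, 4, 2, 3, 1, 2, 3, 4, 1, 2, 1] @ [E 3] @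
      map R [1, 2, 1, 4, 3, 2, 1, 3, 2, 4, 3] @ [R 1, R 2, E 3, R 2, R 1])"
    unfolding eX_def Xs_def using 1 3
    by (intro exI[of _ "[[E 3], [R 2, E 3, R 2], map R [3, 4, 2, 3, 1, 2, 3, 4, 1, 2, 1] @ [E 3]
      @ map R (rev [3, 4, 2, 3, 1, 2, 3, 4, 1, 2, 1]), [R 1, R 2, E 3, R 2, R 1]]"]) simp
qed

text \<open>Once \<open>e3 r2 e3\<close> has become \<open>e3 e2 e3\<close>, the trailing reflection
  is absorbed by \<open>b8\<close>.\<close>

lemma ev_X3: "ev [E 3, R 2, E 3, R 2] x = ev (dpow 0 @ [E 3, R 2, E 3]) x"
  by simp

text \<open>The root \<open>\<epsilon>\<^sub>1 + \<epsilon>\<^sub>4\<close> of \<open>X\<^sub>4\<close> is the image of \<open>\<beta>\<^sub>3\<close> under a reflection \<open>n\<close> with \<open>e\<^sub>1 e\<^sub>3 n = e\<^sub>1 e\<^sub>3\<close>.\<close>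

lemma absorbs_right_repeat:
  assumes "absorbs_right n [E 1, E 3]"
  shows "ev ([E 1, E 3] @ map R n @ [E 3] @ map R n) x = ev (dpow 1 @ [E 1, E 3]) x"
proof -
  have "e1 (e3 (ev (map R n) y)) = e1 (e3 y)" for y
    using assms by (simp add: absorbs_right_def)
  then show ?thesis
    by (simp add: dpow_def)
qed

lemmas ev_X4 = absorbs_right_repeat[of "[3, 4, 2, 3, 2, 1, 2, 3, 2, 4, 3]", OF reflections_e1e3(8)]

text \<open>The root element of \<epsilon>_1 + \<epsilon>_4 contributes only a factor \<delta>,
  since the other three roots already give the middle word.\<close>

lemma ev_X5:
  "ev ([E 3, R 2, E 3, R 2] @ map R [3, 4, 2, 3, 1, 2, 3, 4, 1, 2, 1] @ [E 3] @
      map R [1, 2, 1, 4, 3, 2, 1, 3, 2, 4, 3] @ [R 1, R 2, E 3, R 2, R 1]) x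
    = ev (dpow 1 @ [E 3, R 2, R 1, E 3, R 2, E 3]) x"
  by (simp add: dpow_def)

section \<open>Normal forms relative to coset representatives\<close>

lemma list_all2_ex: "list_all2 P xs ys \<Longrightarrow> x \<in> set xs \<Longrightarrow>
  \<exists>y. P x y"
  by (induction rule: list_all2_induct) auto

text \<open>A stabiliser word is inserted next to its reverse on each side of M: one of the two
  completes the word of the coset representative, the other is processed by M. The pair cancels
  letter by letter, so the new words for the representatives are never compared with other words. On
  the right, what M does not absorb must come from a generator in \<open>gc\<close>, and it makes up
  the middle factor.\<close>

lemma shape_exists:
  assumes DL: "lcr DL (gen gl)" and DR: "lcr DR (gen gr)"
    and L: "list_all2 (\<lambda>\<gamma> n. wword (refl \<gamma>) n \<and> slides M n) gl nl"
    and R: "list_all2 (\<lambda>\<gamma> n. wword (refl \<gamma>) n \<and> (absorbs_right n M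
      \<or> \<gamma> \<in> set gc \<and> commutes n M)) gr nr"
    and UV: "set U \<subseteq> {1..4}" "set V \<subseteq> {1..4}"
    and M': "\<And>x. ev M' x = ev (dpow s @ M) x"
  shows "\<exists>y. shape DL M' (gen gc) DR y \<and> ev (map R U @ M @ map R V) = ev (dpow (- s)
    @ y)"
proof -
  \<comment> \<open>The word V on the right is not identified as a group element: it joins the right
    factor before that factor is split into cosets.\<close>
  have left: "\<exists>N V. wword (rprod as) N \<and> set V \<subseteq> {1..4} \<and>
    (\<forall>x. ev (map R N @ M) x = ev (M @ map R V) x)"
    if "set as \<subseteq> set gl" for as
    using that
  proof (induction as)
    case Nil
    show ?case
      by (intro exI[of _ "[]"]) (simp add: wword_def id_def)
  next
    case (Cons \<gamma> as)
    then obtain N V where N: "wword (rprod as) N" "set V \<subseteq> {1..4}"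
      "\<And>x. ev (map R N @ M) x = ev (M @ map R V) x" by auto
    obtain n where n: "wword (refl \<gamma>) n" "slides M n"
      using list_all2_ex[OF L] Cons.prems by auto
    have w: "wword (rprod (\<gamma> # as)) (n @ N)"
      using wword_append[OF n(1) N(1)] by (simp add: rprod_Cons)
    have "absorbs_left n M \<or> commutes n M" "set n \<subseteq> {1..4}"
      using n(2) by (simp_all add: slides_def)
    then show ?case
    proof (elim disjE)
      assume "absorbs_left n M"
      then have "\<forall>x. ev (map R (n @ N) @ M) x = ev (M @ map R V) x"
        using N(3) by (simp add: absorbs_left_def)
      with w N(2) show ?thesis by blast
    next
      assume "commutes n M"
      then have "\<forall>x. ev (map R (n @ N) @ M) x = ev (M @ map R (n @ V)) x"
        using N(3) by (simp add: commutes_def)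
      moreover have "set (n @ V) \<subseteq> {1..4}"
        using \<open>set n \<subseteq> {1..4}\<close> N(2) by simp
      ultimately show ?thesis using w by blast
    qed
  qed
  have right: "\<exists>N C c. wword (rprod as) N \<and> c \<in> gen gc \<and> wword c C \<and>
    (\<forall>x. ev (M @ map R N) x = ev (M @ map R C) x)"
    if "set as \<subseteq> set gr" for as
    using that
  proof (induction as)
    case Nil
    show ?case
      using wword_Nil id_in_gen[of gc] by (intro exI[of _ "[]"] exI[of _ id]) (simp add: id_def)
  next
    case (Cons \<gamma> as)
    then obtain N C c where N: "wword (rprod as) N" "c \<in> gen gc" "wword c C"
      "\<And>x. ev (M @ map R N) x = ev (M @ map R C) x" by auto
    obtain n where n: "wword (refl \<gamma>) n" "absorbs_right n M \<or> \<gamma> \<in> set gc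
      \<and> commutes n M"
      using list_all2_ex[OF R] Cons.prems by auto
    have w: "wword (rprod (\<gamma> # as)) (n @ N)"
      using wword_append[OF n(1) N(1)] by (simp add: rprod_Cons)
    from n(2) show ?case
    proof (elim disjE conjE)
      assume "absorbs_right n M"
      then have "\<forall>x. ev (M @ map R (n @ N)) x = ev (M @ map R C) x"
        using N(4) by (simp add: absorbs_right_def)
      with w N show ?thesis by blast
    next
      assume c: "\<gamma> \<in> set gc" "commutes n M"
      \<comment> \<open>The word n is moved to the left of M, so that the induction hypothesis
        applies to M N, and then back to the right.\<close>
      have "ev (M @ map R (n @ N)) x = ev (M @ map R (n @ C)) x" for x
      proof -
        have "ev (M @ map R (n @ N)) x = ev (map R n) (ev (M @ map R N) x)"
          using c(2) by (simp add: commutes_def)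
        also have "\<dots> = ev (M @ map R (n @ C)) x"
          using c(2) by (subst N(4)) (simp add: commutes_def)
        finally show ?thesis .
      qed
      with w gen_Cons[OF c(1) N(2)] wword_append[OF n(1) N(3)] show ?thesis by blast
    qed
  qed
  obtain u as where u: "u \<in> DL" "set as \<subseteq> set gl" "rprod (map beta U) = u \<circ>
    rprod as"
    using DL rprod_in_WF4[OF UV(1)] unfolding lcr_def gen_def by blast
  obtain N V' where N: "wword (rprod as) N" "set V' \<subseteq> {1..4}"
      "\<And>x. ev (map R N @ M) x = ev (M @ map R V') x"
    using left[OF u(2)] by blast
  have U: "wword (rprod (map beta U)) U"
    using UV(1) by (simp add: wword_def)
  \<comment> \<open>The word for the representative u is the given U followed by the reverse of the
    stabiliser word.\<close>
  have "wword (rprod (map beta U) \<circ> inv (rprod as)) (U @ rev N)"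
    by (intro wword_append wword_rev U N)
  moreover have "rprod (map beta U) \<circ> inv (rprod as) = u"
    using wword_inv_cancel(2)[OF N(1)] by (simp add: u(3) o_assoc[symmetric])
  ultimately have uU: "wimg u (map R (U @ rev N))"
    unfolding wimg_def by blast
  \<comment> \<open>\<open>lcr\<close> speaks of left cosets, while the right-hand factor has to be
    the inverse of a representative; hence the right factor is inverted before it is split, and the
    stabiliser part comes back as \<open>rev bs\<close>.\<close>
  define X where "X = rev (V' @ V)"
  have X: "set X \<subseteq> {1..4}"
    using N(2) UV(2) by (simp add: X_def)
  obtain w bs where w: "w \<in> DR" "set bs \<subseteq> set gr" "rprod (map beta X) = w \<circ>
    rprod bs"
    using DR rprod_in_WF4[OF X] unfolding lcr_def gen_def by blast
  obtain N' C c where N': "wword (rprod (rev bs)) N'" "c \<in> gen gc" "wword c C"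
      "\<And>x. ev (M @ map R N') x = ev (M @ map R C) x"
    using right[of "rev bs"] w(2) by auto
  have bs: "wword (rprod bs) (rev N')"
    using wword_rev[OF N'(1)] by (simp flip: rprod_rev)
  have "wword (rprod bs \<circ> inv (rprod (map beta X))) (rev N' @ rev X)"
    using X by (intro wword_append wword_rev bs) (simp add: wword_def)
  moreover have "rprod bs \<circ> inv (rprod (map beta X)) = inv w"
  proof -
    obtain W where W: "wword w W"
      using w(1) DR WF4_wword unfolding lcr_def by blast
    have "bij w" "bij (rprod bs)"
      using wword_inv_cancel[OF W] wword_inv_cancel[OF bs] by (auto intro: o_bij)
    then have "inv (w \<circ> rprod bs) = inv (rprod bs) \<circ> inv w"
      by (rule o_inv_distrib)
    then show ?thesis
      using wword_inv_cancel(2)[OF bs] by (simp add: w(3) o_assoc)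
  qed
  ultimately have wW: "wimg (inv w) (map R (rev N' @ V' @ V))"
    unfolding wimg_def by (auto simp: X_def)
  have cC: "wimg c (map R C)"
    using N'(3) unfolding wimg_def by blast
  have sets: "set N \<subseteq> {1..4}" "set N' \<subseteq> {1..4}"
    using N(1) N'(1) by (simp_all add: wword_def)
  let ?y = "map R (U @ rev N) @ M' @ map R C @ map R (rev N' @ V' @ V)"
  have "shape DL M' (gen gc) DR ?y"
    by (rule shapeI[OF u(1) N'(2) w(1) uU cC wW])
  moreover have "ev (map R U @ M @ map R V) x = ev (dpow (- s) @ ?y) x" for x
  proof -
    have "ev (dpow (- s) @ ?y) x =
        ev (dpow (- s)) (ev (map R (U @ rev N)) (ev (dpow s)
          (ev (M @ map R C) (ev (map R (rev N' @ V' @ V)) x))))"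
      by (simp add: M')
    also have "\<dots> = ev (map R (U @ rev N)) (ev (dpow (- s)) (ev (dpow s)
        (ev (M @ map R C) (ev (map R (rev N' @ V' @ V)) x))))"
      by (rule ev_dpow[symmetric])
    also have "ev (dpow (- s)) (ev (dpow s) z) = z" for z
      by (simp add: dpow_add)
    also have "ev (M @ map R C) (ev (map R (rev N' @ V' @ V)) x) = ev (M @ map R N') (ev (map R
      (rev N' @ V' @ V)) x)"
      by (rule N'(4)[symmetric])
    also have "\<dots> = ev (M @ map R V') (ev (map R V) x)"
      using R_cancel[of "rev N'"] sets(2) by simp
    also have "\<dots> = ev (map R N @ M) (ev (map R V) x)"
      by (rule N(3)[symmetric])
    also have "ev (map R (U @ rev N)) (ev (map R N @ M) (ev (map R V) x)) = ev (map R U @ M @ map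
      R V) x"
      using R_cancel[OF sets(1)] by simp
    finally show ?thesis ..
  qed
  ultimately show ?thesis by blast
qed

lemma shape_brc:
  assumes "lcr DL (gen gl)" "lcr DR (gen gr)"
    and "list_all2 (\<lambda>\<gamma> n. wword (refl \<gamma>) n \<and> slides M n) gl nl"
    and "list_all2 (\<lambda>\<gamma> n. wword (refl \<gamma>) n \<and> (absorbs_right n M \<or>
      \<gamma> \<in> set gc \<and> commutes n M)) gr nr"
    and "set U \<subseteq> {1..4}" "set V \<subseteq> {1..4}"
    and "ev a = ev (dpow k @ map R U @ M @ map R V)"
    and "\<And>x. ev M' x = ev (dpow s @ M) x"
  shows "\<exists>k y. shape DL M' (gen gc) DR y \<and> brc a (dpow k @ y)"
proof -
  obtain y where y: "shape DL M' (gen gc) DR y"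
    "ev (map R U @ M @ map R V) = ev (dpow (- s) @ y)"
    using shape_exists[OF assms(1-6,8)] by blast
  have "ev a x = ev (dpow (k - s) @ y) x" for x
    using assms(7) y(2) by (simp add: dpow_add)
  then have "brc a (dpow (k - s) @ y)"
    by (simp add: brc_iff_ev fun_eq_iff)
  with y(1) show ?thesis by blast
qed

section \<open>The eleven shapes\<close>

lemma Ns_gen:
  "Ns 0 = gen [beta 1, beta 2, beta 3, beta 4]"
  "Ns 1 = gen [beta 1, beta 2, v4 0 0 1 1, beta 4]"
  "Ns 2 = gen [beta 1, beta 3, beta 4, v4 (1/2) (1/2) (1/2) (-1/2)]"
  "Ns 3 = gen [beta 2, beta 3, v4 0 0 0 1, v4 (-1) 0 0 1]"
  "Ns 4 = gen [beta 3, beta 1, v4 (1/2) (1/2) (1/2) (-1/2), v4 (1/2) (-1/2) (1/2) (1/2)]"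
  "Ns 5 = gen [beta 1, beta 2, beta 3, v4 0 0 0 1, v4 1 0 0 0]"
  "N6L = gen [beta 2, beta 3, v4 0 0 0 1, v4 (-1) 0 0 1]"
  "N6R = gen [beta 2, v4 0 0 1 0, v4 0 0 0 1, v4 (-1) 0 0 1]"
  "N8 = gen [beta 2, beta 4, v4 1 0 0 0, v4 0 0 1 0]"
  by (simp_all add: Ns_def WF4_def N6L_def N6R_def N8_def)

text \<open>Writing the trivial group as \<open>gen []\<close> lets the forms without a middle
  factor be instances of the same reduction.\<close>

lemma Cs_gen:
  "Cs 0 = gen [beta 1, beta 2, beta 3, beta 4]"
  "Cs 1 = gen [beta 1, beta 2, v4 0 0 1 1]"
  "Cs 2 = gen [beta 3, beta 4]"
  "Cs 3 = gen [v4 (-1) 0 0 1]"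
  "Cs 4 = gen []"
  "Cs 5 = gen []"
  "C6 = gen [v4 (-1) 0 0 1]"
  "{id} = gen []"
  by (simp_all add: Cs_def WF4_def C6_def gen_Nil)

lemma shape_one:
  assumes "lcr DL (Ns 0)" "lcr DR (Ns 0)" "set U \<subseteq> {1..4}" "set V \<subseteq> {1..4}"
    and "ev a = ev (dpow k @ map R U @ [] @ map R V)"
  shows "\<exists>k y. shape DL [] (Cs 0) DR y \<and> brc a (dpow k @ y)"
  unfolding Cs_gen
proof (rule shape_brc[where s = 0, OF assms(1,2)[unfolded Ns_gen] _ _ assms(3-5)])
  show "list_all2 (\<lambda>\<gamma> n. wword (refl \<gamma>) n \<and> slides [] n)
      [beta 1, beta 2, beta 3, beta 4]
      [[1], [2], [3], [4]]"
    by (simp only: list_all2_Cons list_all2_Nil reflection_words reflection_beta slides_one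
      simp_thms)
  show "list_all2 (\<lambda>\<gamma> n. wword (refl \<gamma>) n \<and>
        (absorbs_right n [] \<or> \<gamma> \<in> set [beta 1, beta 2, beta 3, beta 4] \<and>
          commutes n []))
      [beta 1, beta 2, beta 3, beta 4]
      [[1], [2], [3], [4]]"
    by (simp only: list_all2_Cons list_all2_Nil reflection_words reflection_beta reflections_one
      list.set insert_iff simp_thms)
qed simp

lemma shape_e4:
  assumes "lcr DL (Ns 1)" "lcr DR (Ns 1)" "set U \<subseteq> {1..4}" "set V \<subseteq> {1..4}"
    and "ev a = ev (dpow k @ map R U @ [E 4] @ map R V)"
  shows "\<exists>k y. shape DL [E 4] (Cs 1) DR y \<and> brc a (dpow k @ y)"
  unfolding Cs_gen
proof (rule shape_brc[where s = 0, OF assms(1,2)[unfolded Ns_gen] _ _ assms(3-5)])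
  show "list_all2 (\<lambda>\<gamma> n. wword (refl \<gamma>) n \<and> slides [E 4] n)
      [beta 1, beta 2, v4 0 0 1 1, beta 4]
      [[1], [2], [3, 4, 2, 3, 2, 4, 3], [4]]"
    by (simp only: list_all2_Cons list_all2_Nil reflection_words reflection_beta slides_e4
      simp_thms)
  show "list_all2 (\<lambda>\<gamma> n. wword (refl \<gamma>) n \<and>
        (absorbs_right n [E 4] \<or> \<gamma> \<in> set [beta 1, beta 2, v4 0 0 1 1] \<and>
          commutes n [E 4]))
      [beta 1, beta 2, v4 0 0 1 1, beta 4]
      [[1], [2], [3, 4, 2, 3, 2, 4, 3], [4]]"
    by (simp only: list_all2_Cons list_all2_Nil reflection_words reflection_beta reflections_e4
      list.set insert_iff simp_thms)
qed simp

lemma shape_e1: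
  assumes "lcr DL (Ns 2)" "lcr DR (Ns 2)" "set U \<subseteq> {1..4}" "set V \<subseteq> {1..4}"
    and "ev a = ev (dpow k @ map R U @ [E 1] @ map R V)"
  shows "\<exists>k y. shape DL [E 1] (Cs 2) DR y \<and> brc a (dpow k @ y)"
  unfolding Cs_gen
proof (rule shape_brc[where s = 0, OF assms(1,2)[unfolded Ns_gen] _ _ assms(3-5)])
  show "list_all2 (\<lambda>\<gamma> n. wword (refl \<gamma>) n \<and> slides [E 1] n)
      [beta 1, beta 3, beta 4, v4 (1/2) (1/2) (1/2) (-1/2)]
      [[1], [3], [4], [2, 3, 2, 1, 2, 3, 2]]"
    by (simp only: list_all2_Cons list_all2_Nil reflection_words reflection_beta slides_e1
      simp_thms)
  show "list_all2 (\<lambda>\<gamma> n. wword (refl \<gamma>) n \<and>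
        (absorbs_right n [E 1] \<or> \<gamma> \<in> set [beta 3, beta 4] \<and> commutes n [E 1]))
      [beta 1, beta 3, beta 4, v4 (1/2) (1/2) (1/2) (-1/2)]
      [[1], [3], [4], [2, 3, 2, 1, 2, 3, 2]]"
    by (simp only: list_all2_Cons list_all2_Nil reflection_words reflection_beta reflections_e1
      list.set insert_iff simp_thms)
qed simp

lemma shape_e3r2e3:
  assumes "lcr DL (Ns 3)" "lcr DR (Ns 3)" "set U \<subseteq> {1..4}" "set V \<subseteq> {1..4}"
    and "ev a = ev (dpow k @ map R U @ [E 3, R 2, E 3] @ map R V)"
  shows "\<exists>k y. shape DL [E 3, R 2, E 3, R 2] (Cs 3) DR y \<and> brc a (dpow k @ y)"
  unfolding Cs_gen
proof (rule shape_brc[where s = 0, OF assms(1,2)[unfolded Ns_gen] _ _ assms(3-5)])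
  show "list_all2 (\<lambda>\<gamma> n. wword (refl \<gamma>) n \<and> slides [E 3, R 2, E 3] n)
      [beta 2, beta 3, v4 0 0 0 1, v4 (-1) 0 0 1]
      [[2], [3], [4, 3, 2, 3, 4], [1, 2, 3, 2, 1]]"
    by (simp only: list_all2_Cons list_all2_Nil reflection_words reflection_beta slides_e3r2e3
      simp_thms)
  show "list_all2 (\<lambda>\<gamma> n. wword (refl \<gamma>) n \<and>
        (absorbs_right n [E 3, R 2, E 3] \<or> \<gamma> \<in> set [v4 (-1) 0 0 1] \<and> commutes
          n [E 3, R 2, E 3]))
      [beta 2, beta 3, v4 0 0 0 1, v4 (-1) 0 0 1]
      [[2], [3], [4, 3, 2, 3, 4], [1, 2, 3, 2, 1]]"
    by (simp only: list_all2_Cons list_all2_Nil reflection_words reflection_beta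
      reflections_e3r2e3 list.set insert_iff simp_thms)
qed (rule ev_X3)

lemma shape_e1e3:
  assumes "lcr DL (Ns 4)" "lcr DR (Ns 4)" "set U \<subseteq> {1..4}" "set V \<subseteq> {1..4}"
    and "ev a = ev (dpow k @ map R U @ [E 1, E 3] @ map R V)"
  shows "\<exists>k y. shape DL ([E 1, E 3] @ map R [3, 4, 2, 3, 2, 1, 2, 3, 2, 4, 3] @ [E 3] @
    map R [3, 4, 2, 3, 2, 1, 2, 3, 2, 4, 3]) (Cs 4) DR y \<and> brc a (dpow k @ y)"
  unfolding Cs_gen
\<comment> \<open>The element e_X for X_4 is \<delta> times the middle word, by
  \<open>ev_X4\<close>.\<close>
proof (rule shape_brc[where s = 1, OF assms(1,2)[unfolded Ns_gen] _ _ assms(3-5)])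
  show "list_all2 (\<lambda>\<gamma> n. wword (refl \<gamma>) n \<and> slides [E 1, E 3] n)
      [beta 3, beta 1, v4 (1/2) (1/2) (1/2) (-1/2), v4 (1/2) (-1/2) (1/2) (1/2)]
      [[3], [1], [2, 3, 2, 1, 2, 3, 2], [3, 4, 2, 3, 2, 1, 2, 3, 2, 4, 3]]"
    by (simp only: list_all2_Cons list_all2_Nil reflection_words reflection_beta slides_e1e3
      simp_thms)
  show "list_all2 (\<lambda>\<gamma> n. wword (refl \<gamma>) n \<and>
        (absorbs_right n [E 1, E 3] \<or> \<gamma> \<in> set [] \<and> commutes n [E 1, E 3]))
      [beta 3, beta 1, v4 (1/2) (1/2) (1/2) (-1/2), v4 (1/2) (-1/2) (1/2) (1/2)]
      [[3], [1], [2, 3, 2, 1, 2, 3, 2], [3, 4, 2, 3, 2, 1, 2, 3, 2, 4, 3]]"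
    by (simp only: list_all2_Cons list_all2_Nil reflection_words reflection_beta reflections_e1e3
      list.set insert_iff simp_thms)
qed (rule ev_X4)

lemma shape_e3r2r1e3r2e3:
  assumes "lcr DL (Ns 5)" "lcr DR (Ns 5)" "set U \<subseteq> {1..4}" "set V \<subseteq> {1..4}"
    and "ev a = ev (dpow k @ map R U @ [E 3, R 2, R 1, E 3, R 2, E 3] @ map R V)"
  shows "\<exists>k y. shape DL ([E 3, R 2, E 3, R 2] @ map R [3, 4, 2, 3, 1, 2, 3, 4, 1, 2, 1] @
    [E 3] @
      map R [1, 2, 1, 4, 3, 2, 1, 3, 2, 4, 3] @ [R 1, R 2, E 3, R 2, R 1]) (Cs 5) DR y \<and> brc
        a (dpow k @ y)"
  unfolding Cs_gen
\<comment> \<open>The same factor \<delta> separates e_X for X_5 from its middle word, by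
  \<open>ev_X5\<close>.\<close>
proof (rule shape_brc[where s = 1, OF assms(1,2)[unfolded Ns_gen] _ _ assms(3-5)])
  show "list_all2 (\<lambda>\<gamma> n. wword (refl \<gamma>) n \<and> slides
    [E 3, R 2, R 1, E 3, R 2, E 3] n)
      [beta 1, beta 2, beta 3, v4 0 0 0 1, v4 1 0 0 0]
      [[1], [2], [3], [4, 3, 2, 3, 4], [1, 2, 3, 4, 2, 3, 2, 1, 2, 3, 2, 4, 3, 2, 1]]"
    by (simp only: list_all2_Cons list_all2_Nil reflection_words reflection_beta
      slides_e3r2r1e3r2e3 simp_thms)
  show "list_all2 (\<lambda>\<gamma> n. wword (refl \<gamma>) n \<and>
        (absorbs_right n [E 3, R 2, R 1, E 3, R 2, E 3] \<or> \<gamma> \<in> set [] \<and>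
          commutes n [E 3, R 2, R 1, E 3, R 2, E 3]))
      [beta 1, beta 2, beta 3, v4 0 0 0 1, v4 1 0 0 0]
      [[1], [2], [3], [4, 3, 2, 3, 4], [1, 2, 3, 4, 2, 3, 2, 1, 2, 3, 2, 4, 3, 2, 1]]"
    by (simp only: list_all2_Cons list_all2_Nil reflection_words reflection_beta
      reflections_e3r2r1e3r2e3 list.set insert_iff simp_thms)
qed (rule ev_X5)

lemma shape_e3e2:
  assumes "lcr DL N6L" "lcr DR N6R" "set U \<subseteq> {1..4}" "set V \<subseteq> {1..4}"
    and "ev a = ev (dpow k @ map R U @ [E 3, E 2] @ map R V)"
  shows "\<exists>k y. shape DL [E 3, E 2] C6 DR y \<and> brc a (dpow k @ y)"
  unfolding Cs_gen
proof (rule shape_brc[where s = 0, OF assms(1,2)[unfolded Ns_gen] _ _ assms(3-5)])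
  show "list_all2 (\<lambda>\<gamma> n. wword (refl \<gamma>) n \<and> slides [E 3, E 2] n)
      [beta 2, beta 3, v4 0 0 0 1, v4 (-1) 0 0 1]
      [[2], [3], [4, 3, 2, 3, 4], [1, 2, 3, 2, 1]]"
    by (simp only: list_all2_Cons list_all2_Nil reflection_words reflection_beta slides_e3e2
      simp_thms)
  show "list_all2 (\<lambda>\<gamma> n. wword (refl \<gamma>) n \<and>
        (absorbs_right n [E 3, E 2] \<or> \<gamma> \<in> set [v4 (-1) 0 0 1] \<and> commutes n
          [E 3, E 2]))
      [beta 2, v4 0 0 1 0, v4 0 0 0 1, v4 (-1) 0 0 1]
      [[2], [3, 2, 3], [4, 3, 2, 3, 4], [1, 2, 3, 2, 1]]"
    by (simp only: list_all2_Cons list_all2_Nil reflection_words reflection_beta reflections_e3e2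
      list.set insert_iff simp_thms)
qed simp

lemma shape_e2e3:
  assumes "lcr DL N6R" "lcr DR N6L" "set U \<subseteq> {1..4}" "set V \<subseteq> {1..4}"
    and "ev a = ev (dpow k @ map R U @ [E 2, E 3] @ map R V)"
  shows "\<exists>k y. shape DL [E 2, E 3] C6 DR y \<and> brc a (dpow k @ y)"
  unfolding Cs_gen
proof (rule shape_brc[where s = 0, OF assms(1,2)[unfolded Ns_gen] _ _ assms(3-5)])
  show "list_all2 (\<lambda>\<gamma> n. wword (refl \<gamma>) n \<and> slides [E 2, E 3] n)
      [beta 2, v4 0 0 1 0, v4 0 0 0 1, v4 (-1) 0 0 1]
      [[2], [3, 2, 3], [4, 3, 2, 3, 4], [1, 2, 3, 2, 1]]"
    by (simp only: list_all2_Cons list_all2_Nil reflection_words reflection_beta slides_e2e3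
      simp_thms)
  show "list_all2 (\<lambda>\<gamma> n. wword (refl \<gamma>) n \<and>
        (absorbs_right n [E 2, E 3] \<or> \<gamma> \<in> set [v4 (-1) 0 0 1] \<and> commutes n
          [E 2, E 3]))
      [beta 2, beta 3, v4 0 0 0 1, v4 (-1) 0 0 1]
      [[2], [3], [4, 3, 2, 3, 4], [1, 2, 3, 2, 1]]"
    by (simp only: list_all2_Cons list_all2_Nil reflection_words reflection_beta reflections_e2e3
      list.set insert_iff simp_thms)
qed simp

lemma shape_e4r3e2e3e4:
  assumes "lcr DL N8" "lcr DR N8" "set U \<subseteq> {1..4}" "set V \<subseteq> {1..4}"
    and "ev a = ev (dpow k @ map R U @ [E 4, R 3, E 2, E 3, E 4] @ map R V)"
  shows "\<exists>k y. shape DL [E 4, R 3, E 2, E 3, E 4] {id} DR y \<and> brc a (dpow k @ y)"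
  unfolding Cs_gen
proof (rule shape_brc[where s = 0, OF assms(1,2)[unfolded Ns_gen] _ _ assms(3-5)])
  show "list_all2 (\<lambda>\<gamma> n. wword (refl \<gamma>) n \<and> slides
    [E 4, R 3, E 2, E 3, E 4] n)
      [beta 2, beta 4, v4 1 0 0 0, v4 0 0 1 0]
      [[2], [4], [1, 2, 3, 4, 2, 3, 2, 1, 2, 3, 2, 4, 3, 2, 1], [3, 2, 3]]"
    by (simp only: list_all2_Cons list_all2_Nil reflection_words reflection_beta
      slides_e4r3e2e3e4 simp_thms)
  show "list_all2 (\<lambda>\<gamma> n. wword (refl \<gamma>) n \<and>
        (absorbs_right n [E 4, R 3, E 2, E 3, E 4] \<or> \<gamma> \<in> set [] \<and> commutes n
          [E 4, R 3, E 2, E 3, E 4]))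
      [beta 2, beta 4, v4 1 0 0 0, v4 0 0 1 0]
      [[2], [4], [1, 2, 3, 4, 2, 3, 2, 1, 2, 3, 2, 4, 3, 2, 1], [3, 2, 3]]"
    by (simp only: list_all2_Cons list_all2_Nil reflection_words reflection_beta
      reflections_e4r3e2e3e4 list.set insert_iff simp_thms)
qed simp

lemma shape_e3e2e1e3:
  assumes "lcr DL (Ns 5)" "lcr DR (Ns 4)" "set U \<subseteq> {1..4}" "set V \<subseteq> {1..4}"
    and "ev a = ev (dpow k @ map R U @ [E 3, E 2, E 1, E 3] @ map R V)"
  shows "\<exists>k y. shape DL [E 3, E 2, E 1, E 3] {id} DR y \<and> brc a (dpow k @ y)"
  unfolding Cs_gen
proof (rule shape_brc[where s = 0, OF assms(1,2)[unfolded Ns_gen] _ _ assms(3-5)])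
  show "list_all2 (\<lambda>\<gamma> n. wword (refl \<gamma>) n \<and> slides
    [E 3, E 2, E 1, E 3] n)
      [beta 1, beta 2, beta 3, v4 0 0 0 1, v4 1 0 0 0]
      [[1], [2], [3], [4, 3, 2, 3, 4], [1, 2, 3, 4, 2, 3, 2, 1, 2, 3, 2, 4, 3, 2, 1]]"
    by (simp only: list_all2_Cons list_all2_Nil reflection_words reflection_beta slides_e3e2e1e3
      simp_thms)
  show "list_all2 (\<lambda>\<gamma> n. wword (refl \<gamma>) n \<and>
        (absorbs_right n [E 3, E 2, E 1, E 3] \<or> \<gamma> \<in> set [] \<and> commutes n
          [E 3, E 2, E 1, E 3]))
      [beta 3, beta 1, v4 (1/2) (1/2) (1/2) (-1/2), v4 (1/2) (-1/2) (1/2) (1/2)]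
      [[3], [1], [2, 3, 2, 1, 2, 3, 2], [3, 4, 2, 3, 2, 1, 2, 3, 2, 4, 3]]"
    by (simp only: list_all2_Cons list_all2_Nil reflection_words reflection_beta
      reflections_e3e2e1e3 list.set insert_iff simp_thms)
qed simp

lemma shape_e3e1e2e3:
  assumes "lcr DL (Ns 4)" "lcr DR (Ns 5)" "set U \<subseteq> {1..4}" "set V \<subseteq> {1..4}"
    and "ev a = ev (dpow k @ map R U @ [E 3, E 1, E 2, E 3] @ map R V)"
  shows "\<exists>k y. shape DL [E 3, E 1, E 2, E 3] {id} DR y \<and> brc a (dpow k @ y)"
  unfolding Cs_gen
proof (rule shape_brc[where s = 0, OF assms(1,2)[unfolded Ns_gen] _ _ assms(3-5)])
  show "list_all2 (\<lambda>\<gamma> n. wword (refl \<gamma>) n \<and> slides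
    [E 3, E 1, E 2, E 3] n)
      [beta 3, beta 1, v4 (1/2) (1/2) (1/2) (-1/2), v4 (1/2) (-1/2) (1/2) (1/2)]
      [[3], [1], [2, 3, 2, 1, 2, 3, 2], [3, 4, 2, 3, 2, 1, 2, 3, 2, 4, 3]]"
    by (simp only: list_all2_Cons list_all2_Nil reflection_words reflection_beta slides_e3e1e2e3
      simp_thms)
  show "list_all2 (\<lambda>\<gamma> n. wword (refl \<gamma>) n \<and>
        (absorbs_right n [E 3, E 1, E 2, E 3] \<or> \<gamma> \<in> set [] \<and> commutes n
          [E 3, E 1, E 2, E 3]))
      [beta 1, beta 2, beta 3, v4 0 0 0 1, v4 1 0 0 0]
      [[1], [2], [3], [4, 3, 2, 3, 4], [1, 2, 3, 4, 2, 3, 2, 1, 2, 3, 2, 4, 3, 2, 1]]"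
    by (simp only: list_all2_Cons list_all2_Nil reflection_words reflection_beta
      reflections_e3e1e2e3 list.set insert_iff simp_thms)
qed simp

theorem theorem4p4:
  fixes D :: "nat \<Rightarrow> wel set" and D6L D6R D8 :: "wel set"
  assumes "\<forall>i\<le>5. lcr (D i) (Ns i)"
    and "lcr D6L N6L" and "lcr D6R N6R" and "lcr D8 N8"
  shows "\<forall>a. list_all valid_letter a \<longrightarrow> (\<exists>k::int.
     (\<exists>i\<le>5. \<exists>M y. eX (Xs i) M \<and> shape (D i) M (Cs i) (D i) y \<and> brc a (dpow k @ y))
   \<or> (\<exists>y. shape D6L [E 3, E 2] C6 D6R y \<and> brc a (dpow k @ y))
   \<or> (\<exists>y. shape D6R [E 2, E 3] C6 D6L y \<and> brc a (dpow k @ y))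
   \<or> (\<exists>y. shape D8 [E 4, R 3, E 2, E 3, E 4] {id} D8 y \<and> brc a (dpow k @ y))
   \<or> (\<exists>y. shape (D 5) [E 3, E 2, E 1, E 3] {id} (D 4) y \<and> brc a (dpow k @ y))
   \<or> (\<exists>y. shape (D 4) [E 3, E 1, E 2, E 3] {id} (D 5) y \<and> brc a (dpow k @ y)))"
proof (intro allI impI)
  fix a
  assume "list_all valid_letter a"
  then have "nf a"
    by (rule nf_all)
  then obtain k U M V where M: "M \<in> mids" and UV: "set U \<subseteq> {1..4}" "set V \<subseteq> {1..4}"
    and a: "ev a = ev (dpow k @ map R U @ M @ map R V)"
    unfolding nf_def by blast
  \<comment> \<open>Facts are counted from 1, so the member of \<open>D\<close> numbered i + 1
    concerns the representatives \<open>D i\<close>.\<close>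
  have D: "lcr (D 0) (Ns 0)" "lcr (D 1) (Ns 1)" "lcr (D 2) (Ns 2)" "lcr (D 3) (Ns 3)"
    "lcr (D 4) (Ns 4)" "lcr (D 5) (Ns 5)"
    using assms(1) by simp_all
  show "\<exists>k::int.
     (\<exists>i\<le>5. \<exists>M y. eX (Xs i) M \<and> shape (D i) M (Cs i) (D i) y \<and> brc a (dpow k @ y))
   \<or> (\<exists>y. shape D6L [E 3, E 2] C6 D6R y \<and> brc a (dpow k @ y))
   \<or> (\<exists>y. shape D6R [E 2, E 3] C6 D6L y \<and> brc a (dpow k @ y))
   \<or> (\<exists>y. shape D8 [E 4, R 3, E 2, E 3, E 4] {id} D8 y \<and> brc a (dpow k @ y))
   \<or> (\<exists>y. shape (D 5) [E 3, E 2, E 1, E 3] {id} (D 4) y \<and> brc a (dpow k @ y))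
   \<or> (\<exists>y. shape (D 4) [E 3, E 1, E 2, E 3] {id} (D 5) y \<and> brc a (dpow k @ y))"
    (is "?goal a")
  proof -
    have I: "?goal a" if "i \<le> 5" "eX (Xs i) M"
      "\<exists>k y. shape (D i) M (Cs i) (D i) y \<and> brc a (dpow k @ y)" for i M
      using that by blast
    from M consider "M = []" | "M = [E 4]" | "M = [E 1]" | "M = [E 3, R 2, E 3]" | "M = [E 1, E 3]"
      | "M = [E 3, R 2, R 1, E 3, R 2, E 3]" | "M = [E 3, E 2]" | "M = [E 2, E 3]"
      | "M = [E 4, R 3, E 2, E 3, E 4]" | "M = [E 3, E 2, E 1, E 3]" | "M = [E 3, E 1, E 2, E 3]"
      unfolding mids_def by blast
    then show ?thesis
    proof cases
      case 1
      show ?thesis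
        by (rule I[OF _ eX_0 shape_one[OF D(1,1) UV a[unfolded 1]]]) simp
    next
      case 2
      show ?thesis
        by (rule I[OF _ eX_1 shape_e4[OF D(2,2) UV a[unfolded 2]]]) simp
    next
      case 3
      show ?thesis
        by (rule I[OF _ eX_2 shape_e1[OF D(3,3) UV a[unfolded 3]]]) simp
    next
      case 4
      show ?thesis
        by (rule I[OF _ eX_3 shape_e3r2e3[OF D(4,4) UV a[unfolded 4]]]) simp
    next
      case 5
      show ?thesis
        by (rule I[OF _ eX_4 shape_e1e3[OF D(5,5) UV a[unfolded 5]]]) simp
    next
      case 6
      show ?thesis
        by (rule I[OF _ eX_5 shape_e3r2r1e3r2e3[OF D(6,6) UV a[unfolded 6]]]) simp
    next
      case 7
      show ?thesis using shape_e3e2[OF assms(2,3) UV a[unfolded 7]] by blast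
    next
      case 8
      \<comment> \<open>The two transversals change places with respect to the previous form, as
        D_7^L = D_6^R and D_7^R = D_6^L.\<close>
      show ?thesis using shape_e2e3[OF assms(3,2) UV a[unfolded 8]] by blast
    next
      case 9
      show ?thesis using shape_e4r3e2e3e4[OF assms(4,4) UV a[unfolded 9]] by blast
    next
      case 10
      show ?thesis using shape_e3e2e1e3[OF D(6,5) UV a[unfolded 10]] by blast
    next
      case 11
      show ?thesis using shape_e3e1e2e3[OF D(5,6) UV a[unfolded 11]] by blast
    qed
  qed
qed

end
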